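(* Assume that $T$ is NIP and eliminates $\exists^\infty$, and work in a monster model. Let $X_1,\ldots,X_n$ be definable sets and let $\{Y_b\}_{b\in Z}$ be a definable family of definable subsets of $X_1\times\cdots\times X_n$. Then the set $\{b\in Z ~|~ Y_b \text{ is broad}\}$ is definable.
   Context: For definable sets $X_1,\ldots,X_n$ and a type-definable $Y\subseteq X_1\times\cdots\times X_n$, $Y$ is broad if there exist elements $a_{i,j}\in X_i$ for $1\le i\le n$, $j\in\mathbb{N}$, such that for each fixed $i$ the $a_{i,j}$ are pairwise distinct, and for every function $\eta:[n]\to\mathbb{N}$ the tuple $(a_{1,\eta(1)},\ldots,a_{n,\eta(n)})$ lies in $Y$. Otherwise $Y$ is narrow. *)

theory Defs
  imports Main
begin

unbundle cardinal_syntax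

section \<open>First-order logic\<close>

text \<open>A symbol of a language is a name together with its arity, so that every signature (also one
  without function symbols) is represented. Formulas use de Bruijn indices: in \<open>Ex \<phi>\<close> the index 0
  is bound.\<close>

record ('f, 'p) language =
  fun_syms :: "('f \<times> nat) set"
  rel_syms :: "('p \<times> nat) set"

datatype 'f trm = Var nat | Fun 'f "'f trm list"

datatype ('f, 'p) fm =
    Bot
  | Eq "'f trm" "'f trm"
  | Rel 'p "'f trm list"
  | Neg "('f, 'p) fm"
  | Conj "('f, 'p) fm" "('f, 'p) fm"
  | Ex "('f, 'p) fm"

primrec wf_trm :: "('f, 'p) language \<Rightarrow> 'f trm \<Rightarrow> bool" where
  "wf_trm L (Var i) \<longleftrightarrow> True"
| "wf_trm L (Fun f ts) \<longleftrightarrow> (f, length ts) \<in> fun_syms L \<and> list_all (wf_trm L) ts"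

primrec wf_fm :: "('f, 'p) language \<Rightarrow> ('f, 'p) fm \<Rightarrow> bool" where
  "wf_fm L Bot \<longleftrightarrow> True"
| "wf_fm L (Eq s t) \<longleftrightarrow> wf_trm L s \<and> wf_trm L t"
| "wf_fm L (Rel P ts) \<longleftrightarrow> (P, length ts) \<in> rel_syms L \<and> list_all (wf_trm L) ts"
| "wf_fm L (Neg \<phi>) \<longleftrightarrow> wf_fm L \<phi>"
| "wf_fm L (Conj \<phi> \<psi>) \<longleftrightarrow> wf_fm L \<phi> \<and> wf_fm L \<psi>"
| "wf_fm L (Ex \<phi>) \<longleftrightarrow> wf_fm L \<phi>"

primrec fv_trm :: "'f trm \<Rightarrow> nat set" where
  "fv_trm (Var i) = {i}"
| "fv_trm (Fun f ts) = \<Union> (set (map fv_trm ts))"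

primrec fv :: "('f, 'p) fm \<Rightarrow> nat set" where
  "fv Bot = {}"
| "fv (Eq s t) = fv_trm s \<union> fv_trm t"
| "fv (Rel P ts) = \<Union> (set (map fv_trm ts))"
| "fv (Neg \<phi>) = fv \<phi>"
| "fv (Conj \<phi> \<psi>) = fv \<phi> \<union> fv \<psi>"
| "fv (Ex \<phi>) = {i. Suc i \<in> fv \<phi>}"

text \<open>The \<open>L\<close>-formulas in the free variables \<open>x\<^sub>0, \<dots>, x\<^sub>m\<^sub>-\<^sub>1\<close>.\<close>

definition formulas :: "('f, 'p) language \<Rightarrow> nat \<Rightarrow> ('f, 'p) fm set" where
  "formulas L m = {\<phi>. wf_fm L \<phi> \<and> fv \<phi> \<subseteq> {..<m}}"

text \<open>The universe of a structure is the whole type \<open>'m\<close>. Interpretations of symbols outside the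
  language are irrelevant junk.\<close>

record ('f, 'p, 'm) struct =
  fun_int :: "'f \<Rightarrow> 'm list \<Rightarrow> 'm"
  rel_int :: "'p \<Rightarrow> 'm list \<Rightarrow> bool"

primrec eval_trm :: "('f, 'p, 'm) struct \<Rightarrow> (nat \<Rightarrow> 'm) \<Rightarrow> 'f trm \<Rightarrow> 'm" where
  "eval_trm M e (Var i) = e i"
| "eval_trm M e (Fun f ts) = fun_int M f (map (eval_trm M e) ts)"

primrec sat :: "('f, 'p, 'm) struct \<Rightarrow> (nat \<Rightarrow> 'm) \<Rightarrow> ('f, 'p) fm \<Rightarrow> bool" where
  "sat M e Bot \<longleftrightarrow> False"
| "sat M e (Eq s t) \<longleftrightarrow> eval_trm M e s = eval_trm M e t"
| "sat M e (Rel P ts) \<longleftrightarrow> rel_int M P (map (eval_trm M e) ts)"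
| "sat M e (Neg \<phi>) \<longleftrightarrow> \<not> sat M e \<phi>"
| "sat M e (Conj \<phi> \<psi>) \<longleftrightarrow> sat M e \<phi> \<and> sat M e \<psi>"
| "sat M e (Ex \<phi>) \<longleftrightarrow> (\<exists>x. sat M (case_nat x e) \<phi>)"

text \<open>\<open>holds M \<phi> xs\<close> is only used for \<open>\<phi> \<in> formulas L (length xs)\<close>, so that the value of \<open>xs ! i\<close>
  beyond the length of the list plays no role.\<close>

definition holds :: "('f, 'p, 'm) struct \<Rightarrow> ('f, 'p) fm \<Rightarrow> 'm list \<Rightarrow> bool" where
  "holds M \<phi> xs \<longleftrightarrow> sat M (\<lambda>i. xs ! i) \<phi>"

definition is_model :: "('f, 'p, 'm) struct \<Rightarrow> ('f, 'p) fm set \<Rightarrow> bool" where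
  "is_model M T \<longleftrightarrow> (\<forall>\<sigma>\<in>T. holds M \<sigma> [])"


section \<open>Monster models\<close>

text \<open>A family of formulas \<open>\<phi>(x, ps)\<close> in one variable \<open>x\<close> with parameters \<open>ps\<close> is given by the
  pairs \<open>(\<phi>, ps)\<close>.\<close>

definition realizes ::
    "('f, 'p, 'm) struct \<Rightarrow> 'm \<Rightarrow> (('f, 'p) fm \<times> 'm list) set \<Rightarrow> bool" where
  "realizes M x \<Phi> \<longleftrightarrow> (\<forall>(\<phi>, ps)\<in>\<Phi>. holds M \<phi> (x # ps))"

definition saturated ::
    "('f, 'p) language \<Rightarrow> 'k rel \<Rightarrow> ('f, 'p, 'm) struct \<Rightarrow> bool" where
  "saturated L \<kappa> M \<longleftrightarrow>
     (\<forall>A \<Phi>. |A| <o \<kappa> \<and>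
        (\<forall>(\<phi>, ps)\<in>\<Phi>. \<phi> \<in> formulas L (Suc (length ps)) \<and> set ps \<subseteq> A) \<and>
        (\<forall>\<Psi>. finite \<Psi> \<and> \<Psi> \<subseteq> \<Phi> \<longrightarrow> (\<exists>x. realizes M x \<Psi>)) \<longrightarrow>
        (\<exists>x. realizes M x \<Phi>))"

definition elementary_map_on ::
    "('f, 'p) language \<Rightarrow> ('f, 'p, 'm) struct \<Rightarrow> 'm set \<Rightarrow> ('m \<Rightarrow> 'm) \<Rightarrow> bool" where
  "elementary_map_on L M A g \<longleftrightarrow>
     (\<forall>xs. set xs \<subseteq> A \<longrightarrow>
        (\<forall>\<phi>\<in>formulas L (length xs). holds M \<phi> (map g xs) \<longleftrightarrow> holds M \<phi> xs))"

definition automorphism ::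
    "('f, 'p) language \<Rightarrow> ('f, 'p, 'm) struct \<Rightarrow> ('m \<Rightarrow> 'm) \<Rightarrow> bool" where
  "automorphism L M \<sigma> \<longleftrightarrow> bij \<sigma> \<and>
     (\<forall>f xs. (f, length xs) \<in> fun_syms L \<longrightarrow> \<sigma> (fun_int M f xs) = fun_int M f (map \<sigma> xs)) \<and>
     (\<forall>P xs. (P, length xs) \<in> rel_syms L \<longrightarrow> rel_int M P (map \<sigma> xs) = rel_int M P xs)"

definition strongly_homogeneous ::
    "('f, 'p) language \<Rightarrow> 'k rel \<Rightarrow> ('f, 'p, 'm) struct \<Rightarrow> bool" where
  "strongly_homogeneous L \<kappa> M \<longleftrightarrow>
     (\<forall>A g. |A| <o \<kappa> \<and> elementary_map_on L M A g \<longrightarrow>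
        (\<exists>\<sigma>. automorphism L M \<sigma> \<and> (\<forall>x\<in>A. \<sigma> x = g x)))"

text \<open>A monster model of \<open>T\<close>, with respect to a cardinal \<open>\<kappa>\<close> greater than \<open>|L| + \<aleph>\<^sub>0\<close>.\<close>

definition monster_model ::
    "('f, 'p) language \<Rightarrow> ('f, 'p) fm set \<Rightarrow> 'k rel \<Rightarrow> ('f, 'p, 'm) struct \<Rightarrow> bool" where
  "monster_model L T \<kappa> M \<longleftrightarrow>
     Card_order \<kappa> \<and> natLeq <o \<kappa> \<and> |fun_syms L| <o \<kappa> \<and> |rel_syms L| <o \<kappa> \<and>
     is_model M T \<and> saturated L \<kappa> M \<and> strongly_homogeneous L \<kappa> M"


section \<open>NIP and elimination of \<open>\<exists>\<^sup>\<infinity>\<close>\<close>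

text \<open>HOL cannot quantify over models in all types at once, so the models of \<open>T\<close> are taken with
  universe a type \<open>'m\<close> that is passed explicitly. If \<open>T\<close> is complete, both notions hold for all models
  of \<open>T\<close> as soon as they hold for one sufficiently saturated model, so nothing is lost when \<open>'m\<close> is
  the universe of a monster model.

  In \<open>\<phi>(x; y)\<close> the tuple \<open>x\<close> has length \<open>p\<close> and \<open>y\<close> has length \<open>q\<close>; \<open>\<phi>\<close> is NIP if some finite
  \<open>m\<close> bounds the size of the sets of \<open>p\<close>-tuples that it shatters in models of \<open>T\<close>.\<close>

definition shatters ::
    "('f, 'p, 'm) struct \<Rightarrow> ('f, 'p) fm \<Rightarrow> nat \<Rightarrow> nat \<Rightarrow> nat \<Rightarrow> bool" where
  "shatters M \<phi> p q m \<longleftrightarrow>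
     (\<exists>(a :: nat \<Rightarrow> 'm list) (b :: nat set \<Rightarrow> 'm list).
        (\<forall>i<m. length (a i) = p) \<and>
        (\<forall>S\<subseteq>{..<m}. length (b S) = q) \<and>
        (\<forall>i<m. \<forall>S\<subseteq>{..<m}. holds M \<phi> (a i @ b S) \<longleftrightarrow> i \<in> S))"

definition NIP :: "'m itself \<Rightarrow> ('f, 'p) language \<Rightarrow> ('f, 'p) fm set \<Rightarrow> bool" where
  "NIP (_ :: 'm itself) L T \<longleftrightarrow>
     (\<forall>p q. \<forall>\<phi>\<in>formulas L (p + q). \<exists>m.
        \<forall>M :: ('f, 'p, 'm) struct. is_model M T \<longrightarrow> \<not> shatters M \<phi> p q m)"

definition eliminates_exists_infinity ::
    "'m itself \<Rightarrow> ('f, 'p) language \<Rightarrow> ('f, 'p) fm set \<Rightarrow> bool" where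
  "eliminates_exists_infinity (_ :: 'm itself) L T \<longleftrightarrow>
     (\<forall>q. \<forall>\<phi>\<in>formulas L (Suc q). \<exists>\<psi>\<in>formulas L q.
        \<forall>M :: ('f, 'p, 'm) struct. is_model M T \<longrightarrow>
          (\<forall>b. length b = q \<longrightarrow> (holds M \<psi> b \<longleftrightarrow> infinite {x. holds M \<phi> (x # b)})))"


section \<open>Definable sets and families\<close>

text \<open>Definable, with parameters \<open>ps\<close>, subsets of \<open>M\<^sup>k\<close>; elements of \<open>M\<^sup>k\<close> are lists of length \<open>k\<close>.\<close>

definition definable ::
    "('f, 'p) language \<Rightarrow> ('f, 'p, 'm) struct \<Rightarrow> nat \<Rightarrow> 'm list set \<Rightarrow> bool" where
  "definable L M k D \<longleftrightarrow>
     (\<exists>ps. \<exists>\<phi>\<in>formulas L (k + length ps). D = {xs. length xs = k \<and> holds M \<phi> (xs @ ps)})"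

text \<open>An element of \<open>X\<^sub>0 \<times> \<dots> \<times> X\<^sub>n\<^sub>-\<^sub>1\<close> is a list of length \<open>n\<close>. If \<open>X i \<subseteq> M\<^bsup>k i\<^esup>\<close>, such an element is
  a list of lists, and \<open>concat\<close> identifies it with an element of \<open>M\<^bsup>k 0 + \<dots> + k (n - 1)\<^esup>\<close>.\<close>

definition cart_prod :: "nat \<Rightarrow> (nat \<Rightarrow> 'a set) \<Rightarrow> 'a list set" where
  "cart_prod n X = {xs. length xs = n \<and> (\<forall>i<n. xs ! i \<in> X i)}"

text \<open>A definable family of subsets of \<open>X\<^sub>0 \<times> \<dots> \<times> X\<^sub>n\<^sub>-\<^sub>1\<close>, indexed by a definable set \<open>Z \<subseteq> M\<^sup>r\<close>. That
  the total set is definable makes every \<open>Y b\<close> with \<open>b \<in> Z\<close> definable.\<close>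

definition definable_family ::
    "('f, 'p) language \<Rightarrow> ('f, 'p, 'm) struct \<Rightarrow> nat \<Rightarrow> (nat \<Rightarrow> nat) \<Rightarrow> (nat \<Rightarrow> 'm list set) \<Rightarrow>
     nat \<Rightarrow> 'm list set \<Rightarrow> ('m list \<Rightarrow> 'm list list set) \<Rightarrow> bool" where
  "definable_family L M n k X r Z Y \<longleftrightarrow>
     definable L M r Z \<and>
     (\<forall>b\<in>Z. Y b \<subseteq> cart_prod n X) \<and>
     definable L M ((\<Sum>i<n. k i) + r) {concat xs @ b | xs b. b \<in> Z \<and> xs \<in> Y b}"


section \<open>Broad and narrow sets\<close>

definition broad :: "nat \<Rightarrow> (nat \<Rightarrow> 'a set) \<Rightarrow> 'a list set \<Rightarrow> bool" where
  "broad n X Y \<longleftrightarrow>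
     (\<exists>a :: nat \<Rightarrow> nat \<Rightarrow> 'a.
        (\<forall>i<n. (\<forall>j. a i j \<in> X i) \<and> inj (a i)) \<and>
        (\<forall>\<eta> :: nat \<Rightarrow> nat. map (\<lambda>i. a i (\<eta> i)) [0..<n] \<in> Y))"

abbreviation narrow :: "nat \<Rightarrow> (nat \<Rightarrow> 'a set) \<Rightarrow> 'a list set \<Rightarrow> bool" where
  "narrow n X Y \<equiv> \<not> broad n X Y"

end

theory Submission
  imports Defs "HOL-Library.FuncSet" "HOL-Library.Nat_Bijection"
begin

text \<open>It suffices to find \<open>N\<close>, uniform in \<open>b\<close>, such that \<open>Y\<^sub>b\<close> is broad as soon as it contains
  an \<open>N \<times> \<dots> \<times> N\<close> grid. The coordinates are enlarged one at a time. Let \<open>C\<close> be the grid in the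
  coordinates other than the \<open>j\<close>-th. By NIP there are \<open>d\<close> points of \<open>C\<close>, with \<open>d\<close> independent of \<open>C\<close>,
  such that every fibre containing them contains a fixed proportion of \<open>C\<close>. The set of all \<open>x\<close> whose
  fibre contains these \<open>d\<close> points is definable with bounded complexity and has at least \<open>N\<close> elements,
  so it is infinite by elimination of \<open>\<exists>\<^sup>\<infinity>\<close>. Infinitely many of these \<open>x\<close> have the same trace on
  \<open>C\<close>, and this trace, being dense in \<open>C\<close>, contains a large grid. When all coordinates have become
  arbitrarily large, saturation gives an infinite grid.\<close>

section \<open>Grids in dense subsets of finite boxes\<close>

text \<open>Taking the set of \<open>x\<close> whose fibre contains all of \<open>C\<close> would
  not do: the number of conditions on \<open>x\<close> would grow with \<open>C\<close>, so the
  threshold for infinity, and with it the size required of coordinate \<open>j\<close>, would depend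
  on the target size of the coordinates already treated. A core of \<open>d\<close> points avoids
  this, because \<open>d\<close> comes from NIP alone and the threshold depends only on
  \<open>d\<close> and the formula. The price is that a fibre through the core is only known to
  contain a share \<open>1 / (2^d * d)\<close> of \<open>C\<close>, and the subgrid found in it is
  smaller than \<open>C\<close>. The treated coordinates absorb this loss, being available in every
  size; each pending coordinate needs a starting size fixed in advance, whatever the target size of
  the treated ones and whatever the parameters. This order of dependence dictates the form of the
  counting lemmas. Uniformity is what gives definability: containing an \<open>N\<close>-grid for
  one fixed \<open>N\<close> is a first-order condition, whereas containing grids of every size is
  an infinite conjunction.\<close>

text \<open>Otherwise every \<open>d\<close>-tuple \<open>q\<close> in \<open>C\<close>, and every subtuple \<open>q\<^sub>S\<close>, lies in a sparse fibre. For a random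
  \<open>q\<close>, a union bound over all \<open>S\<close> and \<open>i \<notin> S\<close> then yields a \<open>q\<close> such that the sparse fibre chosen for
  \<open>q\<^sub>S\<close> avoids all other \<open>q\<^sub>i\<close>, so \<open>q\<close> is shattered.\<close>

lemma dense_witness:
  fixes E :: "'x \<Rightarrow> 'b \<Rightarrow> bool"
  assumes C: "finite C" "C \<noteq> {}"
    and vc: "\<And>q x. \<not> (\<forall>S\<subseteq>{..<d}. \<forall>i<d. E (x S) (q i) \<longleftrightarrow> i \<in> S)"
  shows "\<exists>q. (\<forall>i<d. q i \<in> C) \<and>
    (\<forall>x. (\<forall>i<d. E x (q i)) \<longrightarrow> card C \<le> 2 ^ d * d * card {y \<in> C. E x y})"
proof (rule ccontr)
  assume neg: "\<not> ?thesis"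
  obtain c0 where c0: "c0 \<in> C" using C by blast
  have "\<forall>q. \<exists>x. (\<forall>i<d. q i \<in> C) \<longrightarrow>
      (\<forall>i<d. E x (q i)) \<and> 2 ^ d * d * card {y \<in> C. E x y} < card C"
  proof
    fix q
    show "\<exists>x. (\<forall>i<d. q i \<in> C) \<longrightarrow>
      (\<forall>i<d. E x (q i)) \<and> 2 ^ d * d * card {y \<in> C. E x y} < card C"
    proof (cases "\<forall>i<d. q i \<in> C")
      case True
      then have "\<not> (\<forall>x. (\<forall>i<d. E x (q i)) \<longrightarrow> card C \<le> 2 ^ d * d * card {y \<in> C. E x y})"
        using neg by blast
      then show ?thesis by (auto simp: not_le)
    qed blast
  qed
  from choice[OF this] obtain X where X: "\<And>q. (\<forall>i<d. q i \<in> C) \<Longrightarrow>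
      (\<forall>i<d. E (X q) (q i)) \<and> 2 ^ d * d * card {y \<in> C. E (X q) y} < card C"
    by blast
  \<comment> \<open>\<open>r R q\<close> keeps only the entries of \<open>q\<close> with index in
    \<open>R\<close>. The sparse fibre chosen for it is unaffected by \<open>q i\<close> for
    \<open>i\<close> outside \<open>R\<close>, so \<open>q i\<close> can vary while the fibre stays
    fixed.\<close>
  define r where "r R q = (\<lambda>i. if i \<in> R then q i else c0)" for R :: "nat set" and q
  define bad where "bad p = {q \<in> PiE {..<d} (\<lambda>_. C). E (X (r (fst p) q)) (q (snd p))}" for p
  define I where "I = {p \<in> Pow {..<d} \<times> {..<d}. snd p \<notin> fst p}"
  have finI: "finite I" unfolding I_def by (rule finite_subset[of _ "Pow {..<d} \<times> {..<d}"]) auto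
  have cardI: "card I \<le> 2 ^ d * d"
  proof -
    have "card I \<le> card (Pow {..<d} \<times> {..<d})"
      unfolding I_def by (rule card_mono) auto
    then show ?thesis by (simp add: card_cartesian_product card_Pow)
  qed
  \<comment> \<open>For \<open>d = 0\<close> every configuration is vacuously shattered, against
    \<open>vc\<close>.\<close>
  have dpos: "0 < d"
  proof (rule ccontr)
    assume "\<not> 0 < d"
    then show False using vc by simp
  qed
  have Cpos: "0 < card C" using C by (simp add: card_gt_0_iff)
  have fin: "finite (PiE {..<d} (\<lambda>_. C))" using C by (simp add: finite_PiE)
  have finbad: "finite (bad p)" for p unfolding bad_def using fin by simp
  \<comment> \<open>Condition on the entries of \<open>q\<close> other than the \<open>i\<close>-th:
    less than a share \<open>1 / (2^d * d)\<close> of the values of \<open>q i\<close> falls into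
    the sparse fibre.\<close>
  have bad: "2 ^ d * d * card (bad p) < card C ^ d" if p: "p \<in> I" for p
  proof -
    obtain R i where p_eq: "p = (R, i)" by fastforce
    have R: "R \<subseteq> {..<d}" "i < d" "i \<notin> R" using p unfolding p_eq I_def by auto
    let ?G = "PiE ({..<d} - {i}) (\<lambda>_. C)"
    let ?F = "\<lambda>g. {y \<in> C. E (X (r R g)) y}"
    have finG: "finite ?G" using C by (simp add: finite_PiE)
    have rR: "r R (g(i := y)) = r R g" for g y using R unfolding r_def by auto
    have "bad p \<subseteq> (\<lambda>(g, y). g(i := y)) ` Sigma ?G ?F"
    proof
      fix q assume q: "q \<in> bad p"
      then have q1: "q \<in> PiE {..<d} (\<lambda>_. C)" and q2: "E (X (r R q)) (q i)"
        unfolding bad_def p_eq by auto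
      let ?g = "q(i := undefined)"
      have "?g \<in> ?G" using q1 by (auto simp: PiE_def extensional_def)
      moreover have "q i \<in> ?F ?g" using q1 q2 R rR by (auto simp: PiE_def)
      moreover have "q = ?g(i := q i)" by simp
      ultimately show "q \<in> (\<lambda>(g, y). g(i := y)) ` Sigma ?G ?F"
        by (intro image_eqI[of _ _ "(?g, q i)"]) auto
    qed
    then have "card (bad p) \<le> card ((\<lambda>(g, y). g(i := y)) ` Sigma ?G ?F)"
      by (rule card_mono[rotated]) (use finG C in auto)
    also have "\<dots> \<le> card (Sigma ?G ?F)"
      by (rule card_image_le) (use finG C in auto)
    also have "\<dots> = (\<Sum>g\<in>?G. card (?F g))"
      using finG C by simp
    finally have "2 ^ d * d * card (bad p) \<le> (\<Sum>g\<in>?G. 2 ^ d * d * card (?F g))"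
      by (simp add: sum_distrib_left[symmetric])
    also have "\<dots> < (\<Sum>g\<in>?G. card C)"
    proof (rule sum_strict_mono)
      show "finite ?G" by (fact finG)
      show "?G \<noteq> {}" using C by (simp add: PiE_eq_empty_iff)
      fix g assume g: "g \<in> ?G"
      have "\<forall>j<d. r R g j \<in> C"
        using g R c0 unfolding r_def by (auto simp: PiE_def Pi_def)
      then show "2 ^ d * d * card (?F g) < card C" using X by blast
    qed
    also have "\<dots> = card C ^ d"
      using R C dpos power_minus_mult[of d "card C"] by (simp add: card_PiE)
    finally show ?thesis .
  qed
  \<comment> \<open>Union bound: at most \<open>2^d * d\<close> pairs, each excluding less than the
    share \<open>1 / (2^d * d)\<close> of all tuples.\<close>
  have "card (\<Union>p\<in>I. bad p) < card C ^ d"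
  proof (cases "I = {}")
    case True
    then show ?thesis using Cpos by simp
  next
    case False
    have "2 ^ d * d * card (\<Union>p\<in>I. bad p) \<le> 2 ^ d * d * (\<Sum>p\<in>I. card (bad p))"
      using card_UN_le[OF finI] by (metis mult_le_mono2)
    also have "\<dots> = (\<Sum>p\<in>I. 2 ^ d * d * card (bad p))" by (simp add: sum_distrib_left)
    also have "\<dots> < (\<Sum>p\<in>I. card C ^ d)"
      by (rule sum_strict_mono) (use finI False bad in auto)
    also have "\<dots> \<le> 2 ^ d * d * card C ^ d" using cardI by simp
    finally show ?thesis by simp
  qed
  moreover have "card (PiE {..<d} (\<lambda>_. C)) = card C ^ d" by (simp add: card_PiE)
  ultimately have "\<not> PiE {..<d} (\<lambda>_. C) \<subseteq> (\<Union>p\<in>I. bad p)"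
    by (metis (no_types, lifting) card_mono finite_UN finI not_le finbad)
  then obtain q where q: "q \<in> PiE {..<d} (\<lambda>_. C)" "\<And>p. p \<in> I \<Longrightarrow> q \<notin> bad p" by blast
  have "E (X (r S q)) (q i) \<longleftrightarrow> i \<in> S" if S: "S \<subseteq> {..<d}" "i < d" for S i
  proof
    assume "E (X (r S q)) (q i)"
    then have "q \<in> bad (S, i)" using q(1) unfolding bad_def by simp
    then have "(S, i) \<notin> I" using q(2) by blast
    then show "i \<in> S" using S unfolding I_def by simp
  next
    assume i: "i \<in> S"
    have "\<forall>j<d. r S q j \<in> C" using q c0 unfolding r_def by (auto simp: PiE_def Pi_def)
    then have "E (X (r S q)) (r S q i)" using X S by blast
    then show "E (X (r S q)) (q i)" using i by (simp add: r_def)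
  qed
  then show False using vc[of "\<lambda>S. X (r S q)" q] by blast
qed

section \<open>Boxes, subgrids and density\<close>

definition box :: "'a set list \<Rightarrow> 'a list set" where
  "box As = {w. list_all2 (\<in>) w As}"

definition has_grid :: "('a list \<Rightarrow> bool) \<Rightarrow> nat list \<Rightarrow> bool" where
  "has_grid P ts \<longleftrightarrow>
     (\<exists>As. (\<forall>A\<in>set As. finite A) \<and> map card As = ts \<and> (\<forall>w\<in>box As. P w))"

text \<open>The condition on \<open>S\<close> is density at least \<open>1 / K\<close>, cleared of
  division.\<close>

definition dense_grids :: "nat \<Rightarrow> 'a set list \<Rightarrow> nat list \<Rightarrow> bool" where
  "dense_grids K As ts \<longleftrightarrow>
     (\<forall>S\<subseteq>box As. card (box As) \<le> K * card S \<longrightarrow> has_grid (\<lambda>w. w \<in> S) ts)"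

lemma box_Nil [simp]: "box [] = {[]}"
  by (simp add: box_def)

lemma box_Cons: "box (A # As) = (\<lambda>(a, w). a # w) ` (A \<times> box As)"
  by (auto simp: box_def list_all2_Cons2)

lemma finite_box: "\<forall>A\<in>set As. finite A \<Longrightarrow> finite (box As)"
  by (induction As) (auto simp: box_Cons)

lemma card_box: "card (box As) = prod_list (map card As)"
proof (induction As)
  case (Cons A As)
  have "inj_on (\<lambda>(a, w). a # w) (A \<times> box As)" by (auto simp: inj_on_def)
  then show ?case using Cons by (simp add: box_Cons card_image card_cartesian_product)
qed simp

lemma box_mono: "list_all2 (\<subseteq>) As Bs \<Longrightarrow> box As \<subseteq> box Bs"
  unfolding box_def by (force simp: list_all2_conv_all_nth)

text \<open>Slice \<open>S\<close> along the first coordinate. Many slices have density at least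
  \<open>1 / (2 * K)\<close>, and there are at most \<open>2 ^ V\<close> different slices, so some
  dense slice occurs for \<open>t\<close> values of the first coordinate. A grid inside that common
  slice, times these \<open>t\<close> values, is the required grid.\<close>

lemma dense_grids_Cons:
  fixes ns :: "nat list"
  assumes pos: "\<forall>m\<in>set ns. 0 < m"
    and tail: "\<And>As :: 'a set list. map card As = ns \<Longrightarrow> dense_grids (2 * K) As ts"
  shows "\<exists>N>0. \<forall>As :: 'a set list. map card As = N # ns \<longrightarrow> dense_grids K As (t # ts)"
proof -
  define V where "V = prod_list ns"
  have Vpos: "0 < V" using pos unfolding V_def by (induction ns) auto
  \<comment> \<open>At least \<open>N / (2 * K)\<close> slices are dense; this \<open>N\<close>
    makes that number exceed \<open>t\<close> for each of the \<open>2 ^ V\<close> possible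
    slices.\<close>
  define N where "N = Suc (2 * K * (t * 2 ^ V))"
  have "dense_grids K As' (t # ts)" if As': "map card As' = N # ns" for As' :: "'a set list"
    unfolding dense_grids_def
  proof (intro allI impI)
    fix S assume S: "S \<subseteq> box As'" and dens: "card (box As') \<le> K * card S"
    obtain A As where As'_eq: "As' = A # As" and A: "card A = N" and As: "map card As = ns"
      using As' by (cases As') auto
    have finA: "finite A" using A by (metis N_def card.infinite nat.simps(3))
    have finAs: "finite (box As)"
      using card_box[of As] As Vpos unfolding V_def by (metis card.infinite less_irrefl)
    have cardV: "card (box As) = V" using card_box[of As] As by (simp add: V_def)
    define sl where "sl a = {w. a # w \<in> S}" for a
    have sl: "sl a \<subseteq> box As" for a using S unfolding sl_def As'_eq box_Cons by auto
    have slfin: "finite (sl a)" for a using sl finAs finite_subset by blast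
    have "S = (\<lambda>(a, w). a # w) ` Sigma A sl"
      using S unfolding sl_def As'_eq box_Cons by force
    moreover have "inj_on (\<lambda>(a, w). a # w) (Sigma A sl)" by (auto simp: inj_on_def)
    ultimately have cardS: "card S = (\<Sum>a\<in>A. card (sl a))"
      using finA slfin by (simp add: card_image)
    define G where "G = {a \<in> A. V \<le> 2 * K * card (sl a)}"
    have GA: "G \<subseteq> A" and finG: "finite G" using finA unfolding G_def by auto
    \<comment> \<open>The density bound is doubled so that the sparse slices, which contribute at
      most \<open>N * V\<close>, use up only half of the left-hand side.\<close>
    have "2 * N * V \<le> 2 * K * card S"
      using dens by (simp add: card_box As' V_def)
    also have "\<dots> = (\<Sum>a\<in>A. 2 * K * card (sl a))"
      unfolding cardS by (simp add: sum_distrib_left)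
    also have "\<dots> = (\<Sum>a\<in>G. 2 * K * card (sl a)) + (\<Sum>a\<in>A - G. 2 * K * card (sl a))"
      using GA finA by (metis (no_types, lifting) sum.subset_diff add.commute)
    also have "\<dots> \<le> (\<Sum>a\<in>G. 2 * K * V) + (\<Sum>a\<in>A - G. V)"
    proof (rule add_mono; rule sum_mono)
      fix a assume "a \<in> G"
      show "2 * K * card (sl a) \<le> 2 * K * V"
        using card_mono[OF finAs sl] cardV by simp
    next
      fix a assume "a \<in> A - G"
      then show "2 * K * card (sl a) \<le> V" unfolding G_def by auto
    qed
    also have "\<dots> \<le> 2 * K * card G * V + N * V"
      using card_mono[OF finA, of "A - G"] A by (simp add: mult.commute mult.left_commute)
    finally have "N * V \<le> (2 * K * card G) * V" by simp
    then have "N \<le> 2 * K * card G" using Vpos by simp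
    then have "2 * K * (t * 2 ^ V) < 2 * K * card G" unfolding N_def by linarith
    then have big: "t * 2 ^ V < card G" by simp
    have "\<exists>s\<in>Pow (box As). t < card {a \<in> G. sl a = s}"
    proof (rule ccontr)
      assume "\<not> ?thesis"
      then have small: "card {a \<in> G. sl a = s} \<le> t" if "s \<in> Pow (box As)" for s
        using that by (meson not_le less_imp_le)
      have "card G \<le> card (\<Union>s\<in>Pow (box As). {a \<in> G. sl a = s})"
        by (rule card_mono) (use finG finAs sl in auto)
      also have "\<dots> \<le> (\<Sum>s\<in>Pow (box As). card {a \<in> G. sl a = s})"
        by (rule card_UN_le) (use finAs in auto)
      also have "\<dots> \<le> (\<Sum>s\<in>Pow (box As). t)" by (rule sum_mono) (rule small)
      also have "\<dots> = t * 2 ^ V" using finAs cardV by (simp add: card_Pow)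
      finally show False using big by simp
    qed
    then obtain s where s: "s \<subseteq> box As" "t < card {a \<in> G. sl a = s}" by auto
    from obtain_subset_with_card_n[OF less_imp_le[OF s(2)]]
    obtain B where B: "B \<subseteq> {a \<in> G. sl a = s}" "card B = t" "finite B" by metis
    from s(2) have "{a \<in> G. sl a = s} \<noteq> {}" by (metis card.empty less_zeroE)
    then obtain a where a: "a \<in> G" "sl a = s" by auto
    then have "card (box As) \<le> 2 * K * card s" using cardV unfolding G_def by auto
    then have "has_grid (\<lambda>w. w \<in> s) ts"
      using tail[OF As] s unfolding dense_grids_def by blast
    then obtain Bs where Bs: "\<forall>B\<in>set Bs. finite B" "map card Bs = ts" "box Bs \<subseteq> s"
      unfolding has_grid_def by blast
    have "\<forall>w\<in>box (B # Bs). w \<in> S" using B Bs unfolding box_Cons sl_def by auto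
    then show "has_grid (\<lambda>w. w \<in> S) (t # ts)"
      unfolding has_grid_def using B Bs by (intro exI[of _ "B # Bs"]) auto
  qed
  then show ?thesis unfolding N_def by blast
qed

text \<open>Each coordinate put in front halves the density available to its slices, whence the
  factor \<open>2 ^ length ts\<close>. The sizes \<open>ns\<close> stay untouched: only those placed
  in front of them depend on \<open>ts\<close>.\<close>

lemma dense_grids_append:
  fixes ns :: "nat list"
  assumes "\<forall>m\<in>set ns. 0 < m"
    and "\<And>As :: 'a set list. map card As = ns \<Longrightarrow> dense_grids (2 ^ length ts * K) As us"
  shows "\<exists>ms. length ms = length ts \<and> (\<forall>m\<in>set ms. 0 < m) \<and>
    (\<forall>As :: 'a set list. map card As = ms @ ns \<longrightarrow> dense_grids K As (ts @ us))"
  using assms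
proof (induction ts arbitrary: K)
  case Nil
  then show ?case by simp
next
  case (Cons t ts)
  have "dense_grids (2 ^ length ts * (2 * K)) As us" if "map card As = ns" for As :: "'a set list"
    using Cons.prems(2)[OF that] by (simp add: mult.assoc mult.left_commute)
  from Cons.IH[OF Cons.prems(1) this] obtain ms where ms: "length ms = length ts"
    "\<forall>m\<in>set ms. 0 < m"
    "\<And>As :: 'a set list. map card As = ms @ ns \<Longrightarrow> dense_grids (2 * K) As (ts @ us)" by blast
  have "\<forall>m\<in>set (ms @ ns). 0 < m" using ms(2) Cons.prems(1) by auto
  from dense_grids_Cons[OF this ms(3)] obtain N where "0 < N"
    "\<forall>As :: 'a set list. map card As = N # ms @ ns \<longrightarrow> dense_grids K As (t # ts @ us)" by blast
  then show ?case using ms by (intro exI[of _ "N # ms"]) auto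
qed

lemma dense_grids_Nil: "dense_grids K [] []"
  unfolding dense_grids_def
proof (intro allI impI)
  fix S :: "'a list set" assume "S \<subseteq> box []" "card (box ([] :: 'a set list)) \<le> K * card S"
  then have "S = {[]}" by (cases "S = {}") auto
  then show "has_grid (\<lambda>w. w \<in> S) []" unfolding has_grid_def by simp
qed

text \<open>The sizes \<open>ns\<close> do not depend on \<open>ts\<close>: the coordinates treated first keep
  their size while the others grow.\<close>

lemma dense_grids_sizes:
  "\<exists>ns. length ns = length us \<and> (\<forall>m\<in>set ns. 0 < m) \<and>
    (\<forall>ts. length ts = j \<longrightarrow> (\<exists>ms. length ms = j \<and> (\<forall>m\<in>set ms. 0 < m) \<and>
      (\<forall>As :: 'a set list. map card As = ms @ ns \<longrightarrow> dense_grids K As (ts @ us))))"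
proof -
  \<comment> \<open>\<open>us\<close> is served at density \<open>1 / (2 ^ j * K)\<close>, which is
    what remains after slicing along \<open>j\<close> front coordinates. Only their number enters,
    so \<open>ns\<close> is fixed before \<open>ts\<close> is known.\<close>
  have "dense_grids (2 ^ length us * (2 ^ j * K)) As []" if "map card As = []" for As :: "'a set list"
    using that by (simp add: dense_grids_Nil)
  then have "\<exists>ns. length ns = length us \<and> (\<forall>m\<in>set ns. 0 < m) \<and>
      (\<forall>As :: 'a set list. map card As = ns @ [] \<longrightarrow> dense_grids (2 ^ j * K) As (us @ []))"
    by (intro dense_grids_append) auto
  then obtain ns where ns: "length ns = length us"
    "\<forall>m\<in>set ns. 0 < m" "\<And>As :: 'a set list. map card As = ns \<Longrightarrow> dense_grids (2 ^ j * K) As us"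
    by auto
  have "\<exists>ms. length ms = length ts \<and> (\<forall>m\<in>set ms. 0 < m) \<and>
      (\<forall>As :: 'a set list. map card As = ms @ ns \<longrightarrow> dense_grids K As (ts @ us))"
    if "length ts = j" for ts
    by (rule dense_grids_append) (use ns that in auto)
  then show ?thesis using ns(1,2) by (metis (no_types, lifting))
qed

lemma has_grid_mono:
  assumes "list_all2 (\<le>) ts ts'" "has_grid P ts'"
  shows "has_grid P ts"
proof -
  obtain As where As: "\<forall>A\<in>set As. finite A" "map card As = ts'" "\<forall>w\<in>box As. P w"
    using assms(2) unfolding has_grid_def by blast
  have "\<exists>Bs. map card Bs = ts \<and> list_all2 (\<subseteq>) Bs As"
    using assms(1) As(2)
  proof (induction ts ts' arbitrary: As rule: list_all2_induct)
    case (Cons t ts t' ts')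
    then obtain A As' where A: "As = A # As'" "card A = t'" "map card As' = ts'" by auto
    obtain B where "B \<subseteq> A" "card B = t"
      using obtain_subset_with_card_n[of t A] A(2) Cons(1) by metis
    moreover obtain Bs where "map card Bs = ts" "list_all2 (\<subseteq>) Bs As'" using Cons(3) A by blast
    ultimately show ?case using A by (intro exI[of _ "B # Bs"]) auto
  qed simp
  then obtain Bs where Bs: "map card Bs = ts" "list_all2 (\<subseteq>) Bs As" by blast
  have "\<forall>B\<in>set Bs. finite B"
    using Bs(2) As(1) by (metis finite_subset in_set_conv_nth list_all2_conv_all_nth)
  moreover have "\<forall>w\<in>box Bs. P w" using box_mono[OF Bs(2)] As(3) by blast
  ultimately show ?thesis using Bs(1) unfolding has_grid_def by blast
qed

lemma box_append: "box (As @ Bs) = {u @ v | u v. u \<in> box As \<and> v \<in> box Bs}"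
proof (intro set_eqI iffI)
  fix w assume "w \<in> box (As @ Bs)"
  then show "w \<in> {u @ v | u v. u \<in> box As \<and> v \<in> box Bs}"
    unfolding box_def list_all2_append2 by blast
qed (auto simp: box_def intro: list_all2_appendI)

lemma length_box: "w \<in> box As \<Longrightarrow> length w = length As"
  by (auto simp: box_def dest: list_all2_lengthD)

lemma list_all2_le_replicate:
  fixes ns :: "nat list"
  assumes "length ns = m" "sum_list ns \<le> t"
  shows "list_all2 (\<le>) ns (replicate m t)"
  using assms by (force simp: list_all2_conv_all_nth intro: order_trans[OF member_le_sum_list])

section \<open>Enlarging the coordinates one at a time\<close>

text \<open>Coordinate \<open>j\<close> becomes arbitrarily large while the later ones shrink from
  \<open>t\<close> to \<open>u\<close>. The front sizes \<open>ms\<close> may depend on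
  \<open>M\<close>, since the hypothesis offers every size there; \<open>t\<close> only has to
  dominate \<open>N\<close> and the sizes \<open>ns\<close>, which are independent of
  \<open>M\<close> and \<open>c\<close>.\<close>

lemma grid_step:
  fixes P :: "'c \<Rightarrow> 'a list \<Rightarrow> bool" and d :: nat
  assumes vc: "\<And>c q x. \<not> (\<forall>S\<subseteq>{..<d}. \<forall>i<d. P c (take j (q i) @ x S # drop j (q i)) \<longleftrightarrow> i \<in> S)"
    and inf: "\<And>c q F. finite F \<Longrightarrow> N \<le> card F \<Longrightarrow>
      \<forall>x\<in>F. \<forall>i<d. P c (take j (q i) @ x # drop j (q i)) \<Longrightarrow>
      infinite {x. \<forall>i<d. P c (take j (q i) @ x # drop j (q i))}"
  shows "\<exists>t. \<forall>c. (\<forall>M. has_grid (P c) (replicate j M @ replicate (Suc m) t)) \<longrightarrow>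
    (\<forall>M. has_grid (P c) (replicate (Suc j) M @ replicate m u))"
proof -
  define K where "K = 2 ^ d * d"
  obtain ns where ns: "length ns = m" "\<forall>l\<in>set ns. 0 < l" and
    ns_ms: "\<And>ts. length ts = j \<Longrightarrow> (\<exists>ms. length ms = j \<and> (\<forall>l\<in>set ms. 0 < l) \<and>
      (\<forall>As :: 'a set list. map card As = ms @ ns \<longrightarrow> dense_grids K As (ts @ replicate m u)))"
    using dense_grids_sizes[of "replicate m u" j K, where 'a = 'a] by auto
  define t where "t = N + sum_list ns"
  have "has_grid (P c) (replicate (Suc j) M @ replicate m u)"
    if G: "\<And>M. has_grid (P c) (replicate j M @ replicate (Suc m) t)" for c M
  proof -
    obtain ms where ms: "length ms = j" "\<forall>l\<in>set ms. 0 < l"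
      "\<And>As :: 'a set list. map card As = ms @ ns \<Longrightarrow>
        dense_grids K As (replicate j M @ replicate m u)"
      using ns_ms[of "replicate j M"] by auto
    have "list_all2 (\<le>) (ms @ N # ns) (replicate j (sum_list ms) @ replicate (Suc m) t)"
      using ms ns by (auto intro!: list_all2_appendI list_all2_le_replicate simp: t_def)
    from has_grid_mono[OF this G] obtain As where As: "\<forall>A\<in>set As. finite A"
      "map card As = ms @ N # ns" "\<forall>w\<in>box As. P c w" unfolding has_grid_def by blast
    from As(2) obtain As1 A As2 where As_eq: "As = As1 @ A # As2"
      and cards: "map card As1 = ms" "card A = N" "map card As2 = ns"
      by (auto simp: map_eq_append_conv map_eq_Cons_conv)
    define C where "C = box (As1 @ As2)"
    have len1: "length As1 = j" using cards ms by (metis length_map)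
    have finC: "finite C" unfolding C_def using As(1) As_eq by (intro finite_box) auto
    have "0 < prod_list (ms @ ns)"
      using ms(2) ns(2) by (metis (no_types, lifting) Un_iff gr0I less_irrefl prod_list_zero_iff set_append)
    then have "C \<noteq> {}"
      using card_box[of "As1 @ As2"] cards unfolding C_def by (metis card.empty less_irrefl map_append)
    define E where "E x w = P c (take j w @ x # drop j w)" for x w
    have "\<not> (\<forall>S\<subseteq>{..<d}. \<forall>i<d. E (x S) (q i) \<longleftrightarrow> i \<in> S)" for x q
      using vc unfolding E_def .
    from dense_witness[of C d E, OF finC \<open>C \<noteq> {}\<close> this] obtain q where q: "\<forall>i<d. q i \<in> C"
      "\<forall>x. (\<forall>i<d. E x (q i)) \<longrightarrow> card C \<le> K * card {w \<in> C. E x w}"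
      unfolding K_def by (elim exE conjE)
    have EA: "E x w" if "x \<in> A" "w \<in> C" for x w
    proof -
      obtain w1 w2 where "w = w1 @ w2" "w1 \<in> box As1" "w2 \<in> box As2"
        using \<open>w \<in> C\<close> unfolding C_def box_append by blast
      moreover from this have "length w1 = j" using length_box len1 by metis
      ultimately have "take j w @ x # drop j w \<in> box As"
        unfolding As_eq box_append using \<open>x \<in> A\<close> by (auto simp: box_Cons)
      then show ?thesis using As(3) unfolding E_def by blast
    qed
    \<comment> \<open>\<open>D\<close> is cut out by only \<open>d\<close> conditions and contains
      \<open>A\<close>, which has \<open>N\<close> elements; the threshold for infinity therefore
      applies whatever the size of \<open>C\<close>.\<close>
    define D where "D = {x. \<forall>i<d. E x (q i)}"
    have "infinite D" unfolding D_def E_def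
      by (rule inf[of A]) (use As As_eq cards EA q in \<open>auto simp: E_def\<close>)
    moreover have "finite ((\<lambda>x. {w \<in> C. E x w}) ` D)"
      by (rule finite_subset[of _ "Pow C"]) (use finC in auto)
    ultimately obtain x0 where x0: "x0 \<in> D"
      "infinite {x \<in> D. {w \<in> C. E x w} = {w \<in> C. E x0 w}}"
      using pigeonhole_infinite by blast
    \<comment> \<open>The trace shared by infinitely many \<open>x\<close>. It is dense because
      \<open>x0\<close> is related to every point of the core; any \<open>M\<close> of these
      \<open>x\<close> can be inserted at coordinate \<open>j\<close> of a grid in
      \<open>S\<close>.\<close>
    define S where "S = {w \<in> C. E x0 w}"
    from infinite_arbitrarily_large[OF x0(2)[folded S_def], of M]
    obtain F where F: "F \<subseteq> {x \<in> D. {w \<in> C. E x w} = S}" "card F = M" "finite F"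
      by (elim exE conjE)
    have "card C \<le> K * card S" using q(2) x0 unfolding S_def D_def by blast
    moreover have "S \<subseteq> C" unfolding S_def by blast
    ultimately have "has_grid (\<lambda>w. w \<in> S) (replicate j M @ replicate m u)"
      using ms(3)[of "As1 @ As2"] cards unfolding dense_grids_def C_def by auto
    then obtain Bs where Bs: "\<forall>B\<in>set Bs. finite B" "map card Bs = replicate j M @ replicate m u"
      "box Bs \<subseteq> S" unfolding has_grid_def by blast
    then obtain Bs1 Bs2 where Bs_eq: "Bs = Bs1 @ Bs2"
      and cBs: "map card Bs1 = replicate j M" "map card Bs2 = replicate m u"
      by (auto simp: map_eq_append_conv)
    have lenB: "length Bs1 = j" using cBs by (metis length_map length_replicate)
    have "P c w" if wB: "w \<in> box (Bs1 @ F # Bs2)" for w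
    proof -
      obtain w1 x w2 where w: "w = w1 @ x # w2" "w1 \<in> box Bs1" "x \<in> F" "w2 \<in> box Bs2"
        using wB by (auto simp: box_append box_Cons)
      then have "w1 @ w2 \<in> S" using Bs(3) unfolding Bs_eq box_append by blast
      then have "E x (w1 @ w2)" using F(1) w(3) by blast
      then show ?thesis using length_box[OF w(2)] lenB w(1) unfolding E_def by simp
    qed
    moreover have "map card (Bs1 @ F # Bs2) = replicate (Suc j) M @ replicate m u"
      using cBs F by (simp add: replicate_append_same)
    ultimately show ?thesis
      unfolding has_grid_def using Bs(1) F(3) Bs_eq by (intro exI[of _ "Bs1 @ F # Bs2"]) auto
  qed
  then show ?thesis by blast
qed

text \<open>Sizes are determined backwards: stage \<open>j + 1\<close> with remaining size
  \<open>u\<close> asks stage \<open>j\<close> for a remaining size \<open>t\<close>. The induction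
  therefore keeps \<open>u\<close> arbitrary; at \<open>j = n\<close> nothing remains and its value
  is immaterial.\<close>

lemma uniform_grid_bound:
  fixes P :: "'c \<Rightarrow> 'a list \<Rightarrow> bool"
  assumes vc: "\<And>j. j < n \<Longrightarrow> \<exists>d::nat. \<forall>c q x.
      \<not> (\<forall>S\<subseteq>{..<d}. \<forall>i<d. P c (take j (q i) @ x S # drop j (q i)) \<longleftrightarrow> i \<in> S)"
    and inf: "\<And>j (d::nat). j < n \<Longrightarrow> \<exists>N. \<forall>c q F. finite F \<longrightarrow> N \<le> card F \<longrightarrow>
      (\<forall>x\<in>F. \<forall>i<d. P c (take j (q i) @ x # drop j (q i))) \<longrightarrow>
      infinite {x. \<forall>i<d. P c (take j (q i) @ x # drop j (q i))}"
  shows "\<exists>N. \<forall>c. has_grid (P c) (replicate n N) \<longrightarrow> (\<forall>M. has_grid (P c) (replicate n M))"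
proof -
  have "\<exists>t. \<forall>c. has_grid (P c) (replicate n t) \<longrightarrow>
      (\<forall>M. has_grid (P c) (replicate j M @ replicate (n - j) u))" if "j \<le> n" for j u
    using that
  proof (induction j arbitrary: u)
    case 0
    then show ?case by auto
  next
    case (Suc j)
    then have j: "j < n" by simp
    obtain d :: nat where d: "\<And>c q x.
        \<not> (\<forall>S\<subseteq>{..<d}. \<forall>i<d. P c (take j (q i) @ x S # drop j (q i)) \<longleftrightarrow> i \<in> S)"
      using vc[OF j] by blast
    obtain N where N: "\<And>c q F. finite F \<Longrightarrow> N \<le> card F \<Longrightarrow>
        \<forall>x\<in>F. \<forall>i<d. P c (take j (q i) @ x # drop j (q i)) \<Longrightarrow>
        infinite {x. \<forall>i<d. P c (take j (q i) @ x # drop j (q i))}"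
      using inf[OF j, of d] by blast
    have "\<exists>t. \<forall>c. (\<forall>M. has_grid (P c) (replicate j M @ replicate (Suc (n - Suc j)) t)) \<longrightarrow>
        (\<forall>M. has_grid (P c) (replicate (Suc j) M @ replicate (n - Suc j) u))"
    proof (rule grid_step[of d P j N])
      show "\<not> (\<forall>S\<subseteq>{..<d}. \<forall>i<d. P c (take j (q i) @ x S # drop j (q i)) \<longleftrightarrow> i \<in> S)" for c q x
        by (fact d)
    qed (fact N)
    then obtain t where t: "\<forall>c. (\<forall>M. has_grid (P c) (replicate j M @ replicate (Suc (n - Suc j)) t)) \<longrightarrow>
        (\<forall>M. has_grid (P c) (replicate (Suc j) M @ replicate (n - Suc j) u))" ..
    moreover have "Suc (n - Suc j) = n - j" using j by simp
    moreover obtain t' where "\<forall>c. has_grid (P c) (replicate n t') \<longrightarrow>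
        (\<forall>M. has_grid (P c) (replicate j M @ replicate (n - j) t))"
      using Suc.IH[of t] j by auto
    ultimately show ?case by (metis (no_types))
  qed
  from this[of n 0] show ?thesis by simp
qed

section \<open>Expressible predicates and saturation\<close>

lemma eval_trm_cong:
  "(\<And>i. i \<in> fv_trm t \<Longrightarrow> e i = e' i) \<Longrightarrow> eval_trm M e t = eval_trm M e' t"
proof (induction t)
  case (Fun f ts)
  then have "map (eval_trm M e) ts = map (eval_trm M e') ts" by (intro map_cong) auto
  then show ?case by (metis eval_trm.simps(2))
qed simp

lemma sat_cong:
  "(\<And>i. i \<in> fv \<phi> \<Longrightarrow> e i = e' i) \<Longrightarrow> sat M e \<phi> = sat M e' \<phi>"
proof (induction \<phi> arbitrary: e e')
  case (Eq s t)
  then show ?case using eval_trm_cong[of s e e' M] eval_trm_cong[of t e e' M] by simp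
next
  case (Rel p ts)
  then have "map (eval_trm M e) ts = map (eval_trm M e') ts"
    by (intro map_cong eval_trm_cong) auto
  then show ?case by (metis sat.simps(3))
next
  case (Neg \<phi>)
  then show ?case by (metis fv.simps(4) sat.simps(4))
next
  case (Conj \<phi> \<psi>)
  then show ?case by (metis Un_iff fv.simps(5) sat.simps(5))
next
  case (Ex \<phi>)
  have "sat M (case_nat x e) \<phi> = sat M (case_nat x e') \<phi>" for x
    by (rule Ex.IH) (use Ex.prems in \<open>auto split: nat.split\<close>)
  then show ?case by simp
qed simp

lemma finite_fv_trm: "finite (fv_trm t)"
  by (induction t) auto

lemma finite_fv: "finite (fv \<phi>)"
proof (induction \<phi>)
  case (Ex \<phi>)
  have "fv (Ex \<phi>) = Suc -` fv \<phi>" by auto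
  then show ?case using Ex by (simp add: finite_vimageI)
qed (auto simp: finite_fv_trm)

primrec ren_trm :: "(nat \<Rightarrow> nat) \<Rightarrow> 'f trm \<Rightarrow> 'f trm" where
  "ren_trm \<rho> (Var i) = Var (\<rho> i)"
| "ren_trm \<rho> (Fun f ts) = Fun f (map (ren_trm \<rho>) ts)"

primrec ren :: "(nat \<Rightarrow> nat) \<Rightarrow> ('f, 'p) fm \<Rightarrow> ('f, 'p) fm" where
  "ren \<rho> Bot = Bot"
| "ren \<rho> (Eq s t) = Eq (ren_trm \<rho> s) (ren_trm \<rho> t)"
| "ren \<rho> (Rel p ts) = Rel p (map (ren_trm \<rho>) ts)"
| "ren \<rho> (Neg \<phi>) = Neg (ren \<rho> \<phi>)"
| "ren \<rho> (Conj \<phi> \<psi>) = Conj (ren \<rho> \<phi>) (ren \<rho> \<psi>)"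
| "ren \<rho> (Ex \<phi>) = Ex (ren (case_nat 0 (Suc \<circ> \<rho>)) \<phi>)"

lemma wf_ren_trm: "wf_trm L t \<Longrightarrow> wf_trm L (ren_trm \<rho> t)"
  by (induction t) (auto simp: list_all_iff)

lemma wf_ren: "wf_fm L \<phi> \<Longrightarrow> wf_fm L (ren \<rho> \<phi>)"
  by (induction \<phi> arbitrary: \<rho>) (auto simp: list_all_iff wf_ren_trm)

lemma eval_ren_trm: "eval_trm M e (ren_trm \<rho> t) = eval_trm M (e \<circ> \<rho>) t"
proof (induction t)
  case (Fun f ts)
  then show ?case by (auto simp: comp_def cong: map_cong)
qed simp

lemma sat_ren: "sat M e (ren \<rho> \<phi>) = sat M (e \<circ> \<rho>) \<phi>"
proof (induction \<phi> arbitrary: e \<rho>)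
  case (Rel p ts)
  then show ?case by (simp add: eval_ren_trm comp_def)
next
  case (Ex \<phi>)
  have "case_nat x e \<circ> case_nat 0 (Suc \<circ> \<rho>) = case_nat x (e \<circ> \<rho>)" for x
    by (auto split: nat.split)
  then show ?case using Ex by (simp add: comp_def)
qed (auto simp: eval_ren_trm)

lemma fv_ren_trm: "fv_trm (ren_trm \<rho> t) = \<rho> ` fv_trm t"
  by (induction t) auto

lemma fv_ren: "fv (ren \<rho> \<phi>) \<subseteq> \<rho> ` fv \<phi>"
proof (induction \<phi> arbitrary: \<rho>)
  case (Ex \<phi>)
  show ?case
  proof
    fix i assume "i \<in> fv (ren \<rho> (Ex \<phi>))"
    then have "Suc i \<in> case_nat 0 (Suc \<circ> \<rho>) ` fv \<phi>" using Ex by auto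
    then obtain l where "l \<in> fv \<phi>" "Suc i = case_nat 0 (Suc \<circ> \<rho>) l" by auto
    then show "i \<in> \<rho> ` fv (Ex \<phi>)" by (auto split: nat.splits)
  qed
qed (fastforce simp: fv_ren_trm)+

text \<open>Conditions on assignments are combined semantically, without tracking free variables;
  \<open>expressible_restrict\<close> recovers a formula in a prescribed number of
  variables.\<close>

definition expressible ::
    "('f, 'p) language \<Rightarrow> ('f, 'p, 'm) struct \<Rightarrow> ((nat \<Rightarrow> 'm) \<Rightarrow> bool) \<Rightarrow> bool" where
  "expressible L M P \<longleftrightarrow> (\<exists>\<phi>. wf_fm L \<phi> \<and> (\<forall>e. sat M e \<phi> \<longleftrightarrow> P e))"

lemma expressible_not: "expressible L M P \<Longrightarrow> expressible L M (\<lambda>e. \<not> P e)"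
  unfolding expressible_def by (metis sat.simps(4) wf_fm.simps(4))

lemma expressible_conj:
  "expressible L M P \<Longrightarrow> expressible L M Q \<Longrightarrow> expressible L M (\<lambda>e. P e \<and> Q e)"
  unfolding expressible_def by (metis sat.simps(5) wf_fm.simps(5))

lemma expressible_ball:
  assumes "finite I" "\<And>i. i \<in> I \<Longrightarrow> expressible L M (P i)"
  shows "expressible L M (\<lambda>e. \<forall>i\<in>I. P i e)"
  using assms
proof (induction I rule: finite_induct)
  case empty
  show ?case unfolding expressible_def by (rule exI[of _ "Neg Bot"]) simp
next
  case (insert i I)
  then show ?case using expressible_conj[of L M "P i" "\<lambda>e. \<forall>i\<in>I. P i e"] by simp
qed

lemma expressible_ren: "expressible L M P \<Longrightarrow> expressible L M (\<lambda>e. P (e \<circ> \<rho>))"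
  unfolding expressible_def by (metis sat_ren wf_ren)

lemma expressible_eq: "expressible L M (\<lambda>e. e i = e j)"
  unfolding expressible_def by (rule exI[of _ "Eq (Var i) (Var j)"]) simp

lemma holds_map_cong:
  assumes "\<phi> \<in> formulas L (length js)"
  shows "holds M \<phi> (map e js) \<longleftrightarrow> sat M (e \<circ> (\<lambda>i. js ! i)) \<phi>"
  unfolding holds_def by (rule sat_cong) (use assms in \<open>auto simp: formulas_def\<close>)

lemma expressible_holds:
  assumes "\<phi> \<in> formulas L (length js)"
  shows "expressible L M (\<lambda>e. holds M \<phi> (map e js))"
  unfolding holds_map_cong[OF assms]
  by (rule expressible_ren) (use assms in \<open>auto simp: formulas_def expressible_def\<close>)

lemma expressible_map_eq:
  fixes M :: "('f, 'p, 'm) struct"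
  assumes "length js = length js'"
  shows "expressible L M (\<lambda>e. map e js = map e js')"
proof -
  have eq: "map e js = map e js' \<longleftrightarrow> (\<forall>i\<in>{..<length js}. e (js ! i) = e (js' ! i))"
    for e :: "nat \<Rightarrow> 'm"
    using assms by (auto simp: list_eq_iff_nth_eq)
  show ?thesis unfolding eq by (rule expressible_ball) (auto intro: expressible_eq)
qed

text \<open>\<open>xs\<close> fills the indices bound by a block of \<open>length xs\<close>
  quantifiers, and \<open>e\<close> is shifted behind them.\<close>

definition cat :: "'a list \<Rightarrow> (nat \<Rightarrow> 'a) \<Rightarrow> nat \<Rightarrow> 'a" where
  "cat xs e i = (if i < length xs then xs ! i else e (i - length xs))"

lemma cat_Nil [simp]: "cat [] e = e"
  by (auto simp: cat_def)

lemma cat_Cons: "cat (x # xs) e = case_nat x (cat xs e)"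
  by (auto simp: cat_def fun_eq_iff split: nat.split)

lemma map_cat_upt [simp]: "length xs = p \<Longrightarrow> map (cat xs e) [0..<p] = xs"
  by (auto simp: cat_def intro: nth_equalityI)

lemma sat_Ex_pow:
  "sat M e ((Ex ^^ m) \<phi>) \<longleftrightarrow> (\<exists>xs. length xs = m \<and> sat M (cat xs e) \<phi>)"
proof (induction m arbitrary: \<phi>)
  case (Suc m)
  have "sat M e ((Ex ^^ Suc m) \<phi>) \<longleftrightarrow> (\<exists>xs x. length xs = m \<and> sat M (cat (x # xs) e) \<phi>)"
    using Suc[of "Ex \<phi>"] by (simp add: funpow_swap1 cat_Cons)
  also have "\<dots> \<longleftrightarrow> (\<exists>xs. length xs = Suc m \<and> sat M (cat xs e) \<phi>)"
    by (metis length_Suc_conv)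
  finally show ?case .
qed simp

lemma wf_Ex_pow: "wf_fm L ((Ex ^^ m) \<phi>) \<longleftrightarrow> wf_fm L \<phi>"
  by (induction m) auto

lemma fv_Ex_pow: "fv ((Ex ^^ m) \<phi>) = {i. i + m \<in> fv \<phi>}"
  by (induction m) auto

lemma expressible_ex_list:
  "expressible L M P \<Longrightarrow> expressible L M (\<lambda>e. \<exists>xs. length xs = m \<and> P (cat xs e))"
  unfolding expressible_def by (force simp: sat_Ex_pow wf_Ex_pow intro: exI[of _ "(Ex ^^ m) _"])

text \<open>A formula has finitely many free variables, so all those of index at least
  \<open>k\<close> can be quantified away.\<close>

lemma expressible_restrict:
  assumes "expressible L M P"
  obtains \<phi> where "\<phi> \<in> formulas L k"
    and "\<And>e. sat M e \<phi> \<longleftrightarrow> (\<exists>e'. (\<forall>i<k. e' i = e i) \<and> P e')"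
proof -
  obtain \<psi> where \<psi>: "wf_fm L \<psi>" "\<And>e. sat M e \<psi> \<longleftrightarrow> P e"
    using assms unfolding expressible_def by blast
  obtain m where "\<forall>i\<in>fv \<psi>. i < m"
    using finite_fv[of \<psi>] by (auto simp: finite_nat_set_iff_bounded)
  then have m: "fv \<psi> \<subseteq> {..<k + m}" by force
  \<comment> \<open>The kept variables move behind the \<open>m\<close> quantified ones, the others
    into the indices that the quantifiers bind.\<close>
  define \<rho> where "\<rho> i = (if i < k then m + i else i - k)" for i
  define \<phi> where "\<phi> = (Ex ^^ m) (ren \<rho> \<psi>)"
  have "fv (ren \<rho> \<psi>) \<subseteq> \<rho> ` {..<k + m}" using fv_ren m by blast
  also have "\<dots> \<subseteq> {..<k + m}" by (auto simp: \<rho>_def)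
  finally have "fv \<phi> \<subseteq> {..<k}" unfolding \<phi>_def fv_Ex_pow by auto
  then have "\<phi> \<in> formulas L k" using \<psi>(1) by (simp add: formulas_def \<phi>_def wf_Ex_pow wf_ren)
  moreover have "sat M e \<phi> \<longleftrightarrow> (\<exists>e'. (\<forall>i<k. e' i = e i) \<and> P e')" for e
  proof
    assume "sat M e \<phi>"
    then obtain xs where xs: "length xs = m" "sat M (cat xs e \<circ> \<rho>) \<psi>"
      unfolding \<phi>_def sat_Ex_pow sat_ren by blast
    have "\<forall>i<k. (cat xs e \<circ> \<rho>) i = e i" using xs(1) by (auto simp: cat_def \<rho>_def)
    then show "\<exists>e'. (\<forall>i<k. e' i = e i) \<and> P e'" using xs(2) \<psi>(2) by blast
  next
    assume "\<exists>e'. (\<forall>i<k. e' i = e i) \<and> P e'"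
    then obtain e' where e': "\<forall>i<k. e' i = e i" "P e'" by blast
    let ?xs = "map e' [k..<k + m]"
    have "sat M (cat ?xs e \<circ> \<rho>) \<psi> \<longleftrightarrow> sat M e' \<psi>"
      by (rule sat_cong) (use m e'(1) in \<open>auto simp: cat_def \<rho>_def\<close>)
    then show "sat M e \<phi>" unfolding \<phi>_def sat_Ex_pow sat_ren using e'(2) \<psi>(2)
      by (intro exI[of _ ?xs]) auto
  qed
  ultimately show ?thesis using that by blast
qed

lemma expressible_finite_support:
  assumes "expressible L M P"
  obtains k where "\<And>e e'. (\<forall>i<k. e' i = e i) \<Longrightarrow> P e' \<longleftrightarrow> P e"
proof -
  obtain \<psi> where \<psi>: "\<And>e. sat M e \<psi> \<longleftrightarrow> P e"
    using assms unfolding expressible_def by blast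
  obtain k where "\<forall>i\<in>fv \<psi>. i < k"
    using finite_fv[of \<psi>] by (auto simp: finite_nat_set_iff_bounded)
  then have "P e' \<longleftrightarrow> P e" if "\<forall>i<k. e' i = e i" for e e'
    using \<psi> sat_cong[of \<psi> e' e M] that by blast
  then show ?thesis using that by blast
qed

section \<open>Realizing types in countably many variables\<close>

definition fin_sat :: "((nat \<Rightarrow> 'm) \<Rightarrow> bool) set \<Rightarrow> nat \<Rightarrow> (nat \<Rightarrow> 'm) \<Rightarrow> bool" where
  "fin_sat \<Phi> k e \<longleftrightarrow>
     (\<forall>\<Psi>. finite \<Psi> \<and> \<Psi> \<subseteq> \<Phi> \<longrightarrow> (\<exists>e'. (\<forall>i<k. e' i = e i) \<and> (\<forall>P\<in>\<Psi>. P e')))"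

text \<open>For each finite part of \<open>\<Phi>\<close>, the existence of suitable later values is
  a formula in \<open>x\<close> over the \<open>k\<close> values already fixed. These formulas are
  finitely satisfiable, since finitely many finite parts have a finite union; saturation in one
  variable realizes them all.\<close>

lemma fin_sat_extend:
  fixes M :: "('f, 'p, 'm) struct"
  assumes sat: "saturated L \<kappa> M" and \<kappa>: "natLeq <o \<kappa>"
    and expr: "\<And>P. P \<in> \<Phi> \<Longrightarrow> expressible L M P"
    and fs: "fin_sat \<Phi> k e"
  shows "\<exists>x. fin_sat \<Phi> (Suc k) (e(k := x))"
proof -
  let ?ps = "map e [0..<k]"
  \<comment> \<open>\<open>realizes\<close> puts the new element in front of the parameters, so
    variable \<open>k\<close> becomes variable 0.\<close>
  let ?\<rho> = "\<lambda>i. if i = k then 0 else Suc i"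
  define ext where "ext \<Psi> x \<longleftrightarrow> (\<exists>e'. (\<forall>i<Suc k. e' i = (e(k := x)) i) \<and> (\<forall>P\<in>\<Psi>. P e'))" for \<Psi> x
  have "\<exists>\<chi>. \<chi> \<in> formulas L (Suc k) \<and> (\<forall>x. holds M \<chi> (x # ?ps) \<longleftrightarrow> ext \<Psi> x)"
    if \<Psi>: "finite \<Psi>" "\<Psi> \<subseteq> \<Phi>" for \<Psi>
  proof -
    have "expressible L M (\<lambda>e. \<forall>P\<in>\<Psi>. P e)"
      by (rule expressible_ball) (use \<Psi> expr in auto)
    from expressible_restrict[OF this, where k = "Suc k"] obtain \<phi> where
      \<phi>: "\<phi> \<in> formulas L (Suc k)" "\<And>e. sat M e \<phi> \<longleftrightarrow>
        (\<exists>e'. (\<forall>i<Suc k. e' i = e i) \<and> (\<forall>P\<in>\<Psi>. P e'))" by blast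
    have "fv (ren ?\<rho> \<phi>) \<subseteq> ?\<rho> ` {..<Suc k}"
      using fv_ren[of ?\<rho> \<phi>] \<phi>(1) unfolding formulas_def by blast
    also have "\<dots> \<subseteq> {..<Suc k}" by auto
    finally have "ren ?\<rho> \<phi> \<in> formulas L (Suc k)"
      using \<phi>(1) wf_ren unfolding formulas_def by blast
    moreover have "holds M (ren ?\<rho> \<phi>) (x # ?ps) \<longleftrightarrow> sat M (e(k := x)) \<phi>" for x
      unfolding holds_def sat_ren
      by (rule sat_cong) (use \<phi>(1) in \<open>auto simp: formulas_def less_Suc_eq\<close>)
    ultimately show ?thesis using \<phi>(2) unfolding ext_def by blast
  qed
  then obtain \<chi> where
    \<chi>: "\<And>\<Psi>. finite \<Psi> \<Longrightarrow> \<Psi> \<subseteq> \<Phi> \<Longrightarrow> \<chi> \<Psi> \<in> formulas L (Suc k)"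
    "\<And>\<Psi> x. finite \<Psi> \<Longrightarrow> \<Psi> \<subseteq> \<Phi> \<Longrightarrow> holds M (\<chi> \<Psi>) (x # ?ps) \<longleftrightarrow> ext \<Psi> x"
    by metis
  define \<Gamma> where "\<Gamma> = {(\<chi> \<Psi>, ?ps) | \<Psi>. finite \<Psi> \<and> \<Psi> \<subseteq> \<Phi>}"
  have small: "|set ?ps| <o \<kappa>"
    by (rule ordLess_transitive[OF _ \<kappa>]) (simp add: finite_iff_ordLess_natLeq[symmetric])
  have params: "\<forall>(\<phi>, ps)\<in>\<Gamma>. \<phi> \<in> formulas L (Suc (length ps)) \<and> set ps \<subseteq> set ?ps"
    unfolding \<Gamma>_def using \<chi> by auto
  have "\<exists>x. realizes M x \<Delta>" if \<Delta>: "finite \<Delta>" "\<Delta> \<subseteq> \<Gamma>" for \<Delta>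
  proof -
    have "\<forall>\<delta>\<in>\<Delta>. \<exists>\<Psi>. \<delta> = (\<chi> \<Psi>, ?ps) \<and> finite \<Psi> \<and> \<Psi> \<subseteq> \<Phi>" using \<Delta>(2) unfolding \<Gamma>_def by blast
    from bchoice[OF this] obtain g where
      g: "\<And>\<delta>. \<delta> \<in> \<Delta> \<Longrightarrow> \<delta> = (\<chi> (g \<delta>), ?ps)" "\<And>\<delta>. \<delta> \<in> \<Delta> \<Longrightarrow> finite (g \<delta>)"
        "\<And>\<delta>. \<delta> \<in> \<Delta> \<Longrightarrow> g \<delta> \<subseteq> \<Phi>"
      by blast
    have "finite (\<Union>\<delta>\<in>\<Delta>. g \<delta>) \<and> (\<Union>\<delta>\<in>\<Delta>. g \<delta>) \<subseteq> \<Phi>" using \<Delta>(1) g(2,3) by blast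
    from mp[OF spec[OF fs[unfolded fin_sat_def]] this]
    obtain e' where e': "\<forall>i<k. e' i = e i" "\<forall>P\<in>(\<Union>\<delta>\<in>\<Delta>. g \<delta>). P e'" by blast
    have "ext (g \<delta>) (e' k)" if "\<delta> \<in> \<Delta>" for \<delta>
      unfolding ext_def using e' that by (intro exI[of _ e']) (auto simp: less_Suc_eq)
    then have "holds M (\<chi> (g \<delta>)) (e' k # ?ps)" if "\<delta> \<in> \<Delta>" for \<delta>
      using \<chi>(2)[OF g(2,3)] that by blast
    then have "realizes M (e' k) \<Delta>" unfolding realizes_def using g(1) by fastforce
    then show ?thesis by blast
  qed
  then have "\<forall>\<Delta>. finite \<Delta> \<and> \<Delta> \<subseteq> \<Gamma> \<longrightarrow> (\<exists>x. realizes M x \<Delta>)" by blast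
  from mp[OF spec[OF spec[OF sat[unfolded saturated_def]]] conjI[OF small conjI[OF params this]]]
  obtain x where x: "realizes M x \<Gamma>" ..
  have "fin_sat \<Phi> (Suc k) (e(k := x))"
    unfolding fin_sat_def
  proof (intro allI impI)
    fix \<Psi> assume \<Psi>: "finite \<Psi> \<and> \<Psi> \<subseteq> \<Phi>"
    then have "holds M (\<chi> \<Psi>) (x # ?ps)" using x unfolding realizes_def \<Gamma>_def by blast
    then show "\<exists>e'. (\<forall>i<Suc k. e' i = (e(k := x)) i) \<and> (\<forall>P\<in>\<Psi>. P e')"
      using \<chi>(2) \<Psi> unfolding ext_def by blast
  qed
  then show ?thesis by blast
qed

text \<open>Values are fixed one variable at a time. Each member of \<open>\<Phi>\<close> looks at
  finitely many variables only, so it is decided at a finite stage and passes to the limit.\<close>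

lemma fin_sat_imp_sat:
  fixes M :: "('f, 'p, 'm) struct"
  assumes sat: "saturated L \<kappa> M" and \<kappa>: "natLeq <o \<kappa>"
    and expr: "\<And>P. P \<in> \<Phi> \<Longrightarrow> expressible L M P"
    and fs: "fin_sat \<Phi> k e"
  shows "\<exists>e'. (\<forall>i<k. e' i = e i) \<and> (\<forall>P\<in>\<Phi>. P e')"
proof -
  have "\<exists>f. \<forall>l. (fin_sat \<Phi> (k + l) (f l) \<and> (l = 0 \<longrightarrow> f l = e)) \<and>
      (\<forall>i. i \<noteq> k + l \<longrightarrow> f (Suc l) i = f l i)"
  proof (rule dependent_nat_choice[where P = "\<lambda>l g. fin_sat \<Phi> (k + l) g \<and> (l = 0 \<longrightarrow> g = e)"
        and Q = "\<lambda>l g h. \<forall>i. i \<noteq> k + l \<longrightarrow> h i = g i"])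
    show "\<exists>x. fin_sat \<Phi> (k + 0) x \<and> (0 = 0 \<longrightarrow> x = e)" using fs by simp
    fix x l assume "fin_sat \<Phi> (k + l) x \<and> (l = 0 \<longrightarrow> x = e)"
    then obtain y where "fin_sat \<Phi> (Suc (k + l)) (x(k + l := y))"
      using fin_sat_extend[OF sat \<kappa> expr] by blast
    then show "\<exists>y. (fin_sat \<Phi> (k + Suc l) y \<and> (Suc l = 0 \<longrightarrow> y = e)) \<and>
        (\<forall>i. i \<noteq> k + l \<longrightarrow> y i = x i)" by (intro exI[of _ "x(k + l := y)"]) auto
  qed
  then obtain f where f: "\<forall>l. fin_sat \<Phi> (k + l) (f l)" "f 0 = e"
    "\<forall>l i. i \<noteq> k + l \<longrightarrow> f (Suc l) i = f l i"
    by blast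
  have stable: "f (l + a) i = f l i" if "i < k + l" for l a i
    by (induction a) (use that f(3) in auto)
  \<comment> \<open>Stage \<open>l\<close> is final below \<open>k + l\<close>, so index
    \<open>i\<close> is settled by stage \<open>Suc i\<close>.\<close>
  define e' where "e' i = f (Suc i) i" for i
  have e'_f: "e' i = f l i" if "i < k + l" for i l
    using stable[of i l "Suc i"] stable[of i "Suc i" l] that unfolding e'_def
    by (simp add: add.commute)
  have "P e'" if P: "P \<in> \<Phi>" for P
  proof -
    obtain m where m: "\<And>e e'. (\<forall>i<m. e' i = e i) \<Longrightarrow> P e' \<longleftrightarrow> P e"
      using expressible_finite_support[OF expr[OF P]] by blast
    obtain d where d: "\<forall>i<k + m. d i = f m i" "P d"
      using f(1)[rule_format, of m, unfolded fin_sat_def, rule_format, of "{P}"] P by auto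
    then show ?thesis using m[of e' d] e'_f by auto
  qed
  moreover have "\<forall>i<k. e' i = e i" using e'_f[of _ 0] f(2) by auto
  ultimately show ?thesis by blast
qed

lemma chain_imp_sat:
  fixes M :: "('f, 'p, 'm) struct"
  assumes "saturated L \<kappa> M" "natLeq <o \<kappa>"
    and expr: "\<And>N :: nat. expressible L M (R N)"
    and anti: "\<And>N N' e. N \<le> N' \<Longrightarrow> R N' e \<Longrightarrow> R N e"
    and ex: "\<And>N. \<exists>e'. (\<forall>i<k. e' i = e i) \<and> R N e'"
  shows "\<exists>e'. (\<forall>i<k. e' i = e i) \<and> (\<forall>N. R N e')"
proof -
  have "fin_sat (range R) k e"
    unfolding fin_sat_def
  proof (intro allI impI)
    fix \<Psi> assume "finite \<Psi> \<and> \<Psi> \<subseteq> range R"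
    then obtain I where I: "finite I" "\<Psi> = R ` I" by (meson finite_subset_image)
    then obtain N where N: "\<forall>l\<in>I. l < N" by (auto simp: finite_nat_set_iff_bounded)
    obtain e' where e': "\<forall>i<k. e' i = e i" "R N e'" using ex by blast
    have "R l e'" if "l \<in> I" for l using anti[of l N e'] N e'(2) that by auto
    then show "\<exists>e'. (\<forall>i<k. e' i = e i) \<and> (\<forall>P\<in>\<Psi>. P e')" using e'(1) I(2) by blast
  qed
  then have "\<exists>e'. (\<forall>i<k. e' i = e i) \<and> (\<forall>P\<in>range R. P e')"
    using fin_sat_imp_sat[OF assms(1,2), of "range R" k e] expr by blast
  then show ?thesis by simp
qed

section \<open>Uniform thresholds for infinity\<close>

text \<open>Compactness: without a bound, finiteness of the set (a formula, by elimination) would be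
  consistent with any number of distinct elements, hence by saturation with infinitely many.\<close>

lemma infinite_bound:
  fixes M :: "('f, 'p, 'm) struct"
  assumes ei: "eliminates_exists_infinity TYPE('m) L T" and M: "is_model M T"
    and sat: "saturated L \<kappa> M" "natLeq <o \<kappa>"
    and P: "expressible L M P"
  shows "\<exists>N. \<forall>e F. finite F \<longrightarrow> N \<le> card F \<longrightarrow> F \<subseteq> {x. P (case_nat x e)} \<longrightarrow>
    infinite {x. P (case_nat x e)}"
proof (rule ccontr)
  assume neg: "\<not> ?thesis"
  obtain k where k: "\<And>e e'. (\<forall>i<k. e' i = e i) \<Longrightarrow> P e' \<longleftrightarrow> P e"
    using expressible_finite_support[OF P] by blast
  obtain \<phi> where \<phi>: "\<phi> \<in> formulas L (Suc k)"
    "\<And>e. sat M e \<phi> \<longleftrightarrow> (\<exists>e'. (\<forall>i<Suc k. e' i = e i) \<and> P e')"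
    using expressible_restrict[OF P] by blast
  have \<phi>P: "sat M e \<phi> \<longleftrightarrow> P e" for e
    unfolding \<phi>(2) using k[of _ e] by (metis less_Suc_eq)
  from bspec[OF spec[OF ei[unfolded eliminates_exists_infinity_def], of k] \<phi>(1)]
  obtain \<psi> where \<psi>: "\<psi> \<in> formulas L k" and "\<forall>M :: ('f, 'p, 'm) struct. is_model M T \<longrightarrow>
      (\<forall>b. length b = k \<longrightarrow> (holds M \<psi> b \<longleftrightarrow> infinite {x. holds M \<phi> (x # b)}))"
    by (elim bexE)
  then have \<psi>_inf: "length b = k \<Longrightarrow> holds M \<psi> b \<longleftrightarrow> infinite {x. holds M \<phi> (x # b)}" for b
    using M by simp
  define inf where "inf e \<longleftrightarrow> infinite {x. P (case_nat x e)}" for e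
  have "holds M \<phi> (x # map e [0..<k]) \<longleftrightarrow> sat M (case_nat x e) \<phi>" for x e
    unfolding holds_def
  proof (rule sat_cong)
    fix i assume "i \<in> fv \<phi>"
    then have "i < Suc k" using \<phi>(1) unfolding formulas_def by blast
    then show "(x # map e [0..<k]) ! i = case_nat x e i" by (cases i) auto
  qed
  then have inf_eq: "inf e \<longleftrightarrow> holds M \<psi> (map e [0..<k])" for e
    using \<psi>_inf[of "map e [0..<k]"] \<phi>P unfolding inf_def by simp
  have inf_expr: "expressible L M (\<lambda>e. \<not> inf e)"
    unfolding inf_eq by (intro expressible_not expressible_holds) (use \<psi> in simp)
  \<comment> \<open>The candidates occupy the variables from \<open>k\<close> on, where they cannot
    disturb the parameters of \<open>P\<close>.\<close>
  define R where "R N e \<longleftrightarrow> \<not> inf e \<and> (\<forall>l\<in>{..<N}. P (e \<circ> case_nat (k + l) id)) \<and>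
    (\<forall>l\<in>{..<N}. \<forall>l'\<in>{..<l}. \<not> e (k + l) = e (k + l'))" for N :: nat and e
  have case_comp: "e \<circ> case_nat a id = case_nat (e a) e" for e :: "nat \<Rightarrow> 'm" and a
    by (auto split: nat.split)
  have "expressible L M (R N)" for N
    unfolding R_def
    by (intro expressible_conj inf_expr expressible_ball expressible_ren[OF P] expressible_not
        expressible_eq) auto
  moreover have "R N e" if "N \<le> N'" "R N' e" for N N' e
    using that unfolding R_def by auto
  moreover have "\<exists>e'. (\<forall>i<0. e' i = undefined i) \<and> R N e'" for N
  proof -
    obtain e F where F: "finite F" "N \<le> card F" "F \<subseteq> {x. P (case_nat x e)}" "\<not> inf e"
      using neg unfolding inf_def by blast
    obtain xs where xs: "distinct xs" "set xs = F" using finite_distinct_list[OF F(1)] by blast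
    then have len: "N \<le> length xs" using F(2) distinct_card by metis
    define e' where "e' i = (if i < k then e i else xs ! (i - k))" for i
    have P_eq: "P (case_nat x e') \<longleftrightarrow> P (case_nat x e)" for x
      by (rule k) (auto simp: e'_def split: nat.split)
    have "P (case_nat (xs ! l) e')" if "l < N" for l
      using F(3) xs(2) len that unfolding P_eq by (metis (mono_tags) mem_Collect_eq nth_mem
          order_less_le_trans subsetD)
    then have "R N e'"
      using F(4) len xs(1) unfolding R_def inf_def P_eq case_comp
      by (auto simp: e'_def nth_eq_iff_index_eq)
    then show ?thesis by blast
  qed
  ultimately obtain e where e: "\<And>N. R N e"
    using chain_imp_sat[OF sat, of R 0 undefined] by blast
  have "P (case_nat (e (k + l)) e)" for l using e[of "Suc l"] unfolding R_def case_comp by auto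
  then have "range (\<lambda>l. e (k + l)) \<subseteq> {x. P (case_nat x e)}" by auto
  moreover have dist: "e (k + l') \<noteq> e (k + l)" if "l < l'" for l l'
  proof -
    have "\<forall>l\<in>{..<Suc l'}. \<forall>m\<in>{..<l}. \<not> e (k + l) = e (k + m)"
      using e[of "Suc l'"] unfolding R_def by (elim conjE)
    then show ?thesis using that by simp
  qed
  moreover have "inj (\<lambda>l. e (k + l))"
  proof (rule linorder_injI)
    fix l l' :: nat assume "l < l'"
    then show "e (k + l) \<noteq> e (k + l')" using dist by metis
  qed
  ultimately have "inf e" unfolding inf_def by (metis (no_types, lifting) finite_imageD finite_subset infinite_UNIV_nat)
  then show False using e unfolding R_def by blast
qed

text \<open>A set of \<open>p\<close>-tuples is infinite as soon as one of its coordinate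
  projections is, and each projection is a set of single elements.\<close>

lemma infinite_bound_list:
  fixes M :: "('f, 'p, 'm) struct"
  assumes ei: "eliminates_exists_infinity TYPE('m) L T" and M: "is_model M T"
    and sat: "saturated L \<kappa> M" "natLeq <o \<kappa>"
    and P: "expressible L M P"
  shows "\<exists>N>0. \<forall>e F. finite F \<longrightarrow> N \<le> card F \<longrightarrow> F \<subseteq> {xs. length xs = p \<and> P (cat xs e)} \<longrightarrow>
    infinite {xs. length xs = p \<and> P (cat xs e)}"
proof -
  define D where "D e = {xs. length xs = p \<and> P (cat xs e)}" for e
  have proj: "\<exists>N. \<forall>e F. finite F \<longrightarrow> N \<le> card F \<longrightarrow> F \<subseteq> (\<lambda>xs. xs ! l) ` D e \<longrightarrow>
      infinite ((\<lambda>xs. xs ! l) ` D e)" if l: "l < p" for l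
  proof -
    \<comment> \<open>Behind the \<open>p\<close> quantified entries, variable \<open>p\<close>
      holds the value of the projection; \<open>\<rho>\<close> skips it when \<open>P\<close> is
      evaluated.\<close>
    define \<rho> where "\<rho> i = (if i < p then i else Suc i)" for i
    define Q where "Q e \<longleftrightarrow> (\<exists>xs. length xs = p \<and> cat xs e l = cat xs e p \<and> P (cat xs e \<circ> \<rho>))" for e
    have "expressible L M Q" unfolding Q_def
      by (intro expressible_ex_list[where P = "\<lambda>e. e l = e p \<and> P (e \<circ> \<rho>)"]
          expressible_conj expressible_eq expressible_ren P)
    moreover have "{x. Q (case_nat x e)} = (\<lambda>xs. xs ! l) ` D e" for e
    proof -
      have "cat xs (case_nat x e) \<circ> \<rho> = cat xs e" if "length xs = p" for xs x
        using that by (auto simp: cat_def \<rho>_def fun_eq_iff Suc_diff_le)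
      then have "Q (case_nat x e) \<longleftrightarrow> (\<exists>xs. length xs = p \<and> xs ! l = x \<and> P (cat xs e))" for x
        unfolding Q_def using l by (auto simp: cat_def[of _ _ l] cat_def[of _ _ p])
      then show ?thesis unfolding D_def by auto
    qed
    ultimately show ?thesis using infinite_bound[OF ei M sat, of Q] by simp
  qed
  have "\<exists>N. \<forall>l<p. \<forall>e F. finite F \<longrightarrow> N l \<le> card F \<longrightarrow> F \<subseteq> (\<lambda>xs. xs ! l) ` D e \<longrightarrow>
      infinite ((\<lambda>xs. xs ! l) ` D e)"
    by (rule choice[where Q = "\<lambda>l N. l < p \<longrightarrow> (\<forall>e F. finite F \<longrightarrow> N \<le> card F \<longrightarrow>
      F \<subseteq> (\<lambda>xs. xs ! l) ` D e \<longrightarrow> infinite ((\<lambda>xs. xs ! l) ` D e))", THEN exE])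
      (use proj in blast)+
  then obtain N where N: "\<And>l e F. l < p \<Longrightarrow> finite F \<Longrightarrow> N l \<le> card F \<Longrightarrow>
      F \<subseteq> (\<lambda>xs. xs ! l) ` D e \<Longrightarrow> infinite ((\<lambda>xs. xs ! l) ` D e)" by blast
  \<comment> \<open>If all projections stay within their thresholds, the entries come from a set of
    at most \<open>p * (\<Sum>l<p. N l)\<close> elements; \<open>B\<close> exceeds the number of
    \<open>p\<close>-tuples over it.\<close>
  define B where "B = Suc ((p * (\<Sum>l<p. N l)) ^ p)"
  have "infinite (D e)" if F: "finite F" "B \<le> card F" "F \<subseteq> D e" for e F
  proof (rule ccontr)
    assume fin: "\<not> infinite (D e)"
    define U where "U = (\<Union>l<p. (\<lambda>xs. xs ! l) ` F)"
    have small: "card ((\<lambda>xs. xs ! l) ` F) \<le> (\<Sum>l<p. N l)" if "l < p" for l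
    proof -
      have "card ((\<lambda>xs. xs ! l) ` F) \<le> N l"
        using N[of l "(\<lambda>xs. xs ! l) ` F" e] that F fin by (meson finite_imageI image_mono nat_le_linear)
      also have "\<dots> \<le> (\<Sum>l<p. N l)" using that by (intro member_le_sum) auto
      finally show ?thesis .
    qed
    have "card U \<le> (\<Sum>l<p. card ((\<lambda>xs. xs ! l) ` F))"
      unfolding U_def by (rule card_UN_le) simp
    also have "\<dots> \<le> p * (\<Sum>l<p. N l)"
      using sum_bounded_above[of "{..<p}" "\<lambda>l. card ((\<lambda>xs. xs ! l) ` F)"] small by auto
    finally have cardU: "card U \<le> p * (\<Sum>l<p. N l)" .
    have finU: "finite U" unfolding U_def using F(1) by auto
    have "F \<subseteq> {xs. set xs \<subseteq> U \<and> length xs = p}"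
      using F(3) unfolding D_def U_def by (fastforce simp: in_set_conv_nth)
    then have "card F \<le> card U ^ p"
      using card_mono[OF finite_lists_length_eq[OF finU]] card_lists_length_eq[OF finU] by metis
    also have "\<dots> \<le> (p * (\<Sum>l<p. N l)) ^ p" using cardU by (rule power_mono) simp
    finally show False using F(2) unfolding B_def by simp
  qed
  then show ?thesis unfolding D_def B_def by blast
qed

section \<open>Definable families\<close>

lemma formulas_reindex:
  assumes "\<phi> \<in> formulas L (length js)" "set js \<subseteq> {..<m}"
  shows "\<exists>\<phi>'\<in>formulas L m. \<forall>xs. length xs = m \<longrightarrow>
    (holds M \<phi>' xs \<longleftrightarrow> holds M \<phi> (map ((!) xs) js))"
proof
  have "fv (ren ((!) js) \<phi>) \<subseteq> (!) js ` {..<length js}"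
    using fv_ren[of "(!) js" \<phi>] assms(1) unfolding formulas_def by blast
  also have "\<dots> \<subseteq> {..<m}" using assms(2) by (auto dest: nth_mem)
  finally show "ren ((!) js) \<phi> \<in> formulas L m"
    using assms(1) wf_ren unfolding formulas_def by blast
  show "\<forall>xs. length xs = m \<longrightarrow> (holds M (ren ((!) js) \<phi>) xs \<longleftrightarrow> holds M \<phi> (map ((!) xs) js))"
    unfolding holds_map_cong[OF assms(1)] by (simp add: holds_def sat_ren)
qed

lemma map_nth_infix:
  "map ((!) (us @ xs @ vs)) [length us..<length us + length xs] = xs"
  by (rule nth_equalityI) (auto simp: nth_append)

lemma upt_split: "j < n \<Longrightarrow> [0..<n] = [0..<j] @ j # [Suc j..<n]"
  using upt_add_eq_append[of 0 j "n - j"] upt_conv_Cons[of j n] by simp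

lemma map_length_insert:
  assumes "j < n" "map length (take j w @ x # drop j w) = map k [0..<n]"
  shows "map length (take j w) = map k [0..<j] \<and> length x = k j \<and>
    map length (drop j w) = map k [Suc j..<n]"
proof -
  have "length w = n - 1" using assms by (auto dest: arg_cong[where f = length])
  then have len: "length (map length (take j w)) = length (map k [0..<j])" using assms(1) by simp
  have "[0..<n] = [0..<j] @ j # [Suc j..<n]"
    using upt_split[OF assms(1)] .
  then have "map length (take j w) @ length x # map length (drop j w) =
      map k [0..<j] @ k j # map k [Suc j..<n]"
    using assms(2) by simp
  from iffD1[OF append_eq_append_conv[OF disjI1[OF len]] this] show ?thesis by simp
qed

section \<open>NIP and thresholds for tuples of tuples\<close>

text \<open>The instance of \<open>P c\<close> in \<open>uniform_grid_bound\<close>. The lengths are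
  part of it because \<open>concat\<close> forgets how a list is divided into tuples.\<close>

definition arranged ::
    "('f, 'p, 'm) struct \<Rightarrow> ('f, 'p) fm \<Rightarrow> nat \<Rightarrow> (nat \<Rightarrow> nat) \<Rightarrow> nat \<Rightarrow> 'm list \<Rightarrow> 'm list list \<Rightarrow> bool"
  where "arranged M \<phi> n k q c xs \<longleftrightarrow>
    length c = q \<and> map length xs = map k [0..<n] \<and> holds M \<phi> (concat xs @ c)"

lemma sum_list_split:
  fixes k :: "nat \<Rightarrow> nat"
  assumes "j < n"
  shows "sum_list (map k [0..<n]) = sum_list (map k [0..<j]) + k j + sum_list (map k [Suc j..<n])"
proof -
  have "[0..<n] = [0..<j] @ j # [Suc j..<n]"
    using upt_split[OF assms] .
  then show ?thesis by simp
qed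

lemma arranged_insert:
  assumes "j < n"
  shows "arranged M \<phi> n k q c (take j w @ x # drop j w) \<longleftrightarrow>
    length c = q \<and> length x = k j \<and> map length (take j w) = map k [0..<j] \<and>
    map length (drop j w) = map k [Suc j..<n] \<and>
    holds M \<phi> (concat (take j w) @ x @ concat (drop j w) @ c)"
proof -
  have "[0..<n] = [0..<j] @ j # [Suc j..<n]"
    using upt_split[OF assms] .
  then have "map length (take j w) = map k [0..<j] \<and> length x = k j \<and>
    map length (drop j w) = map k [Suc j..<n] \<Longrightarrow>
    map length (take j w @ x # drop j w) = map k [0..<n]"
    by (simp del: take_map drop_map)
  then have iff: "map length (take j w @ x # drop j w) = map k [0..<n] \<longleftrightarrow>
      length x = k j \<and> map length (take j w) = map k [0..<j] \<and>
      map length (drop j w) = map k [Suc j..<n]"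
    using map_length_insert[OF assms, of w x k] by metis
  show ?thesis
    unfolding arranged_def iff by (simp only: concat_append concat.simps append_assoc conj_assoc)
qed

text \<open>NIP is applied with the coordinates other than \<open>j\<close> as points and coordinate
  \<open>j\<close> together with \<open>c\<close> as parameters. Keeping \<open>c\<close> constant
  only restricts the parameters, so \<open>d\<close> is uniform in \<open>c\<close>.\<close>

lemma arranged_vc:
  fixes M :: "('f, 'p, 'm) struct"
  assumes nip: "NIP TYPE('m) L T" and M: "is_model M T"
    and \<phi>: "\<phi> \<in> formulas L (sum_list (map k [0..<n]) + q)" and j: "j < n"
  shows "\<exists>d::nat. \<forall>c w x. \<not> (\<forall>S\<subseteq>{..<d}. \<forall>i<d.
    arranged M \<phi> n k q c (take j (w i) @ x S # drop j (w i)) \<longleftrightarrow> i \<in> S)"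
proof -
  define a b where "a = sum_list (map k [0..<j])" and "b = sum_list (map k [Suc j..<n])"
  let ?js = "[0..<a] @ [a + b..<a + b + k j] @ [a..<a + b] @ [a + b + k j..<a + b + (k j + q)]"
  have len: "length ?js = sum_list (map k [0..<n]) + q"
    unfolding sum_list_split[OF j] a_def b_def by simp
  have "\<phi> \<in> formulas L (length ?js)" using \<phi> by (simp only: len)
  then have "\<exists>\<phi>'\<in>formulas L (a + b + (k j + q)). \<forall>xs. length xs = a + b + (k j + q) \<longrightarrow>
      (holds M \<phi>' xs \<longleftrightarrow> holds M \<phi> (map ((!) xs) ?js))"
    by (rule formulas_reindex) auto
  then obtain \<phi>' where \<phi>': "\<phi>' \<in> formulas L (a + b + (k j + q))"
    "\<And>xs. length xs = a + b + (k j + q) \<Longrightarrow> holds M \<phi>' xs \<longleftrightarrow> holds M \<phi> (map ((!) xs) ?js)"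
    by blast
  have swap: "holds M \<phi>' ((u @ v) @ (x @ c)) \<longleftrightarrow> holds M \<phi> (u @ x @ v @ c)"
    if "length u = a" "length v = b" "length x = k j" "length c = q" for u v x c
  proof -
    have "map ((!) (u @ v @ x @ c)) ?js = u @ x @ v @ c"
      using map_nth_infix[of "[]" u "v @ x @ c"] map_nth_infix[of "u @ v" x c]
        map_nth_infix[of u v "x @ c"] map_nth_infix[of "u @ v @ x" c "[]"] that
      by (simp add: add.assoc)
    then show ?thesis using \<phi>'(2)[of "u @ v @ x @ c"] that by simp
  qed
  obtain m where m: "\<not> shatters M \<phi>' (a + b) (k j + q) m"
    using nip \<phi>'(1) M unfolding NIP_def by blast
  \<comment> \<open>One point more than the NIP bound: \<open>arranged\<close> yields lengths only
    where it is true, which for the empty set is nowhere. Adding \<open>m\<close> to every set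
    secures the length of \<open>x (insert m S)\<close>.\<close>
  have False if sh: "\<forall>S\<subseteq>{..<Suc m}. \<forall>i<Suc m.
      arranged M \<phi> n k q c (take j (w i) @ x S # drop j (w i)) \<longleftrightarrow> i \<in> S" for c w x
  proof -
    have "arranged M \<phi> n k q c (take j (w i) @ x {..<Suc m} # drop j (w i))" if "i < Suc m" for i
      using sh that by blast
    then have c: "length c = q" and w: "\<And>i. i < Suc m \<Longrightarrow> length (concat (take j (w i))) = a"
      "\<And>i. i < Suc m \<Longrightarrow> length (concat (drop j (w i))) = b"
      and w': "\<And>i. i < Suc m \<Longrightarrow> map length (take j (w i)) = map k [0..<j] \<and>
        map length (drop j (w i)) = map k [Suc j..<n]"
      unfolding arranged_insert[OF j] a_def b_def length_concat by auto
    have xS: "length (x (insert m S)) = k j" if "S \<subseteq> {..<m}" for S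
    proof -
      have "insert m S \<subseteq> {..<Suc m}" using that by auto
      then have "arranged M \<phi> n k q c (take j (w m) @ x (insert m S) # drop j (w m))"
        using sh by blast
      then show ?thesis unfolding arranged_insert[OF j] by blast
    qed
    have "holds M \<phi>' (concat (w i) @ (x (insert m S) @ c)) \<longleftrightarrow> i \<in> S"
      if "i < m" "S \<subseteq> {..<m}" for i S
    proof -
      have i: "i < Suc m" "insert m S \<subseteq> {..<Suc m}" using that by auto
      have "concat (w i) = concat (take j (w i)) @ concat (drop j (w i))"
        by (metis append_take_drop_id concat_append)
      then have "holds M \<phi>' (concat (w i) @ (x (insert m S) @ c)) \<longleftrightarrow>
          arranged M \<phi> n k q c (take j (w i) @ x (insert m S) # drop j (w i))"
        using swap[OF w(1,2)[OF i(1)] xS[OF that(2)] c] w'[OF i(1)] xS[OF that(2)] c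
        unfolding arranged_insert[OF j] by simp
      also have "\<dots> \<longleftrightarrow> i \<in> insert m S" using sh i by blast
      finally show ?thesis using that(1) by auto
    qed
    moreover have "length (concat (w i)) = a + b" if "i < m" for i
      using w(1,2)[of i] that by (metis append_take_drop_id concat_append length_append less_SucI)
    moreover have "length (x (insert m S) @ c) = k j + q" if "S \<subseteq> {..<m}" for S
      using xS[OF that] c by simp
    ultimately have "shatters M \<phi>' (a + b) (k j + q) m"
      unfolding shatters_def
      by (intro exI[of _ "\<lambda>i. concat (w i)"] exI[of _ "\<lambda>S. x (insert m S) @ c"]) blast
    then show False using m by blast
  qed
  then show ?thesis by blast
qed

lemma arranged_infinite:
  fixes M :: "('f, 'p, 'm) struct" and d :: nat
  assumes ei: "eliminates_exists_infinity TYPE('m) L T" and M: "is_model M T"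
    and sat: "saturated L \<kappa> M" "natLeq <o \<kappa>"
    and \<phi>: "\<phi> \<in> formulas L (sum_list (map k [0..<n]) + q)" and j: "j < n"
  shows "\<exists>N. \<forall>c w F. finite F \<longrightarrow> N \<le> card F \<longrightarrow>
    (\<forall>x\<in>F. \<forall>i<d. arranged M \<phi> n k q c (take j (w i) @ x # drop j (w i))) \<longrightarrow>
    infinite {x. \<forall>i<d. arranged M \<phi> n k q c (take j (w i) @ x # drop j (w i))}"
proof (cases "d = 0")
  \<comment> \<open>Without conditions the set consists of all lists.\<close>
  case True
  then show ?thesis by (simp add: infinite_UNIV_listI)
next
  case False
  define a b where "a = sum_list (map k [0..<j])" and "b = sum_list (map k [Suc j..<n])"
  \<comment> \<open>Variables below \<open>k j\<close> hold \<open>x\<close>. Behind them, pairs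
    \<open>(i, v)\<close> with \<open>i < d\<close> address the entries of
    \<open>concat (w i)\<close>, and the spare index \<open>d\<close> addresses those of
    \<open>c\<close>.\<close>
  define js where "js i = map (\<lambda>v. k j + prod_encode (i, v)) [0..<a] @ [0..<k j] @
    map (\<lambda>v. k j + prod_encode (i, v)) [a..<a + b] @
    map (\<lambda>v. k j + prod_encode (d, v)) [0..<q]" for i
  have "length (js i) = sum_list (map k [0..<n]) + q" for i
    unfolding sum_list_split[OF j] js_def a_def b_def by simp
  then have "expressible L M (\<lambda>e. \<forall>i\<in>{..<d}. holds M \<phi> (map e (js i)))"
    using \<phi> by (intro expressible_ball expressible_holds) auto
  from infinite_bound_list[OF ei M sat this, of "k j"] obtain N where N: "0 < N"
    "\<And>e F. finite F \<Longrightarrow> N \<le> card F \<Longrightarrow>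
      F \<subseteq> {x. length x = k j \<and> (\<forall>i\<in>{..<d}. holds M \<phi> (map (cat x e) (js i)))} \<Longrightarrow>
      infinite {x. length x = k j \<and> (\<forall>i\<in>{..<d}. holds M \<phi> (map (cat x e) (js i)))}"
    by blast
  have "infinite {x. \<forall>i<d. arranged M \<phi> n k q c (take j (w i) @ x # drop j (w i))}"
    if F: "finite F" "N \<le> card F"
      "\<forall>x\<in>F. \<forall>i<d. arranged M \<phi> n k q c (take j (w i) @ x # drop j (w i))" for c w F
  proof -
    \<comment> \<open>Positivity of \<open>N\<close> supplies an element of \<open>F\<close>, and
      with it the lengths of \<open>c\<close> and of the pieces of each \<open>w i\<close>.\<close>
    obtain x0 where "x0 \<in> F" using F(2) N(1) by (metis card.empty equals0I not_le)
    then have "\<forall>i<d. arranged M \<phi> n k q c (take j (w i) @ x0 # drop j (w i))" using F(3) by blast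
    then have c: "length c = q" and w: "\<And>i. i < d \<Longrightarrow> map length (take j (w i)) = map k [0..<j]"
      "\<And>i. i < d \<Longrightarrow> map length (drop j (w i)) = map k [Suc j..<n]"
      using False unfolding arranged_insert[OF j] by auto
    define e where "e l = (case prod_decode l of (i, v) \<Rightarrow> if i < d then concat (w i) ! v else c ! v)"
      for l
    have "map (cat x e) (js i) = concat (take j (w i)) @ x @ concat (drop j (w i)) @ c"
      if x: "length x = k j" and i: "i < d" for x i
    proof -
      let ?u = "concat (take j (w i))" and ?v = "concat (drop j (w i))"
      have uv: "length ?u = a" "length ?v = b"
        using w[OF i] unfolding a_def b_def length_concat by simp_all
      have wi: "concat (w i) = ?u @ ?v" by (metis append_take_drop_id concat_append)
      have "cat x e (k j + l) = e l" for l using x by (simp add: cat_def)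
      then have "map (cat x e) (js i) = map ((!) (?u @ ?v)) [0..<a] @ map (cat x e) [0..<k j] @
          map ((!) (?u @ ?v)) [a..<a + b] @ map ((!) c) [0..<q]"
        unfolding js_def using i wi by (simp add: e_def comp_def)
      then show ?thesis
        using map_nth_infix[of "[]" ?u ?v] map_nth_infix[of ?u ?v "[]"] x uv c map_nth[of c]
        by simp
    qed
    then have eq: "{x. \<forall>i<d. arranged M \<phi> n k q c (take j (w i) @ x # drop j (w i))} =
        {x. length x = k j \<and> (\<forall>i\<in>{..<d}. holds M \<phi> (map (cat x e) (js i)))}"
      using False c w unfolding arranged_insert[OF j] by auto
    show ?thesis unfolding eq using N(2)[OF F(1,2), of e] F(3) unfolding eq[symmetric] by blast
  qed
  then show ?thesis by blast
qed

section \<open>Grids as first-order conditions\<close>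

lemma has_grid_replicate:
  "has_grid P (replicate n N) \<longleftrightarrow> (\<exists>a. (\<forall>i<n. inj_on (a i) {..<N}) \<and>
    (\<forall>\<eta>. (\<forall>i<n. \<eta> i < N) \<longrightarrow> P (map (\<lambda>i. a i (\<eta> i)) [0..<n])))"
proof
  assume "has_grid P (replicate n N)"
  then obtain As where As: "\<forall>A\<in>set As. finite A" "map card As = replicate n N"
    "\<forall>w\<in>box As. P w" unfolding has_grid_def by blast
  have len: "length As = n" using As(2) by (metis length_map length_replicate)
  have "\<exists>h. bij_betw h {..<N} (As ! i)" if "i < n" for i
  proof -
    have "card (As ! i) = N" using As(2) that len by (metis nth_map nth_replicate)
    moreover have "finite (As ! i)" using As(1) that len by simp
    ultimately show ?thesis using ex_bij_betw_nat_finite by (metis atLeast0LessThan)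
  qed
  then obtain a where a: "\<And>i. i < n \<Longrightarrow> bij_betw (a i) {..<N} (As ! i)" by metis
  have "map (\<lambda>i. a i (\<eta> i)) [0..<n] \<in> box As" if "\<forall>i<n. \<eta> i < N" for \<eta>
    unfolding box_def using a that len by (auto simp: list_all2_conv_all_nth bij_betw_def)
  then show "\<exists>a. (\<forall>i<n. inj_on (a i) {..<N}) \<and>
    (\<forall>\<eta>. (\<forall>i<n. \<eta> i < N) \<longrightarrow> P (map (\<lambda>i. a i (\<eta> i)) [0..<n]))"
    using a As(3) bij_betw_imp_inj_on by blast
next
  assume "\<exists>a. (\<forall>i<n. inj_on (a i) {..<N}) \<and>
    (\<forall>\<eta>. (\<forall>i<n. \<eta> i < N) \<longrightarrow> P (map (\<lambda>i. a i (\<eta> i)) [0..<n]))"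
  then obtain a where a: "\<And>i. i < n \<Longrightarrow> inj_on (a i) {..<N}"
    "\<And>\<eta>. (\<forall>i<n. \<eta> i < N) \<Longrightarrow> P (map (\<lambda>i. a i (\<eta> i)) [0..<n])" by blast
  let ?As = "map (\<lambda>i. a i ` {..<N}) [0..<n]"
  have "P w" if w: "w \<in> box ?As" for w
  proof -
    have len: "length w = n" using length_box[OF w] by simp
    have "w ! i \<in> a i ` {..<N}" if "i < n" for i
      using w that unfolding box_def by (auto simp: list_all2_conv_all_nth)
    then have "\<exists>l. l < N \<and> w ! i = a i l" if "i < n" for i using that by blast
    then obtain \<eta> where \<eta>: "\<And>i. i < n \<Longrightarrow> \<eta> i < N \<and> w ! i = a i (\<eta> i)" by metis
    then have "w = map (\<lambda>i. a i (\<eta> i)) [0..<n]" using len by (auto intro: nth_equalityI)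
    then show ?thesis using a(2) \<eta> by simp
  qed
  moreover have "map card ?As = replicate n N"
    using a(1) by (auto simp: card_image intro: nth_equalityI)
  ultimately show "has_grid P (replicate n N)"
    unfolding has_grid_def by (intro exI[of _ ?As]) auto
qed

text \<open>Variables below \<open>q\<close> are parameters; \<open>slot q k i l\<close> holds the \<open>l\<close>-th candidate for
  coordinate \<open>i\<close>.\<close>

definition slot :: "nat \<Rightarrow> (nat \<Rightarrow> nat) \<Rightarrow> nat \<Rightarrow> nat \<Rightarrow> nat list" where
  "slot q k i l = map (\<lambda>v. q + prod_encode (i, prod_encode (l, v))) [0..<k i]"

text \<open>\<open>PiE\<close> leaves finitely many choice functions, so the conjunction is finite.
  The slots do not depend on \<open>N\<close>; one assignment satisfying all \<open>N\<close>
  therefore carries an infinite grid.\<close>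

definition grid_env ::
    "('f, 'p, 'm) struct \<Rightarrow> ('f, 'p) fm \<Rightarrow> nat \<Rightarrow> (nat \<Rightarrow> nat) \<Rightarrow> nat \<Rightarrow> nat \<Rightarrow> (nat \<Rightarrow> 'm) \<Rightarrow> bool"
  where "grid_env M \<phi> n k q N e \<longleftrightarrow>
    (\<forall>i\<in>{..<n}. \<forall>l\<in>{..<N}. \<forall>l'\<in>{..<l}. \<not> map e (slot q k i l) = map e (slot q k i l')) \<and>
    (\<forall>\<eta>\<in>PiE {..<n} (\<lambda>_. {..<N}).
      holds M \<phi> (map e (concat (map (\<lambda>i. slot q k i (\<eta> i)) [0..<n]) @ [0..<q])))"

lemma length_slot [simp]: "length (slot q k i l) = k i"
  by (simp add: slot_def)

lemma length_concat_slot: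
  "length (concat (map (\<lambda>i. slot q k i (\<eta> i)) [0..<n])) = sum_list (map k [0..<n])"
  by (simp add: length_concat comp_def)

lemma expressible_grid_env:
  assumes "\<phi> \<in> formulas L (sum_list (map k [0..<n]) + q)"
  shows "expressible L M (grid_env M \<phi> n k q N)"
proof -
  have "\<phi> \<in> formulas L (length (concat (map (\<lambda>i. slot q k i (\<eta> i)) [0..<n]) @ [0..<q]))" for \<eta>
    using assms by (simp add: length_concat_slot)
  then show ?thesis
    unfolding grid_env_def
    by (intro expressible_conj expressible_ball expressible_not expressible_map_eq
        expressible_holds finite_PiE) auto
qed

lemma grid_env_mono:
  assumes "N \<le> N'" "grid_env M \<phi> n k q N' e"
  shows "grid_env M \<phi> n k q N e"
proof -
  have "PiE {..<n} (\<lambda>_. {..<N}) \<subseteq> PiE {..<n} (\<lambda>_. {..<N'})"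
    using assms(1) by (intro PiE_mono) auto
  then show ?thesis using assms unfolding grid_env_def by auto
qed

lemma arranged_slots:
  "arranged M \<phi> n k q (map e [0..<q]) (map (\<lambda>i. map e (slot q k i (\<eta> i))) [0..<n]) \<longleftrightarrow>
    holds M \<phi> (map e (concat (map (\<lambda>i. slot q k i (\<eta> i)) [0..<n]) @ [0..<q]))"
  by (simp add: arranged_def map_concat comp_def)

lemma grid_env_arranged:
  assumes "grid_env M \<phi> n k q N e" "\<forall>i<n. \<eta> i < N"
  shows "arranged M \<phi> n k q (map e [0..<q]) (map (\<lambda>i. map e (slot q k i (\<eta> i))) [0..<n])"
proof -
  have "restrict \<eta> {..<n} \<in> PiE {..<n} (\<lambda>_. {..<N})" using assms(2) by auto
  then have "holds M \<phi> (map e (concat (map (\<lambda>i. slot q k i (restrict \<eta> {..<n} i)) [0..<n]) @ [0..<q]))"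
    using assms(1) unfolding grid_env_def by blast
  moreover have "map (\<lambda>i. slot q k i (restrict \<eta> {..<n} i)) [0..<n] = map (\<lambda>i. slot q k i (\<eta> i)) [0..<n]"
    by simp
  ultimately show ?thesis unfolding arranged_slots by metis
qed

lemma grid_env_inj:
  assumes "grid_env M \<phi> n k q N e" "i < n"
  shows "inj_on (\<lambda>l. map e (slot q k i l)) {..<N}"
proof (rule linorder_inj_onI)
  fix l l' assume "l < l'" "l \<in> {..<N}" "l' \<in> {..<N}"
  then show "map e (slot q k i l) \<noteq> map e (slot q k i l')"
    using assms unfolding grid_env_def by (metis lessThan_iff)
qed auto

lemma grid_env_iff:
  fixes e :: "nat \<Rightarrow> 'm"
  shows "(\<exists>e'. (\<forall>i<q. e' i = e i) \<and> grid_env M \<phi> n k q N e') \<longleftrightarrow>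
    has_grid (arranged M \<phi> n k q (map e [0..<q])) (replicate n N)"
proof
  assume "\<exists>e'. (\<forall>i<q. e' i = e i) \<and> grid_env M \<phi> n k q N e'"
  then obtain e' where e': "\<forall>i<q. e' i = e i" "grid_env M \<phi> n k q N e'" by blast
  have params: "map e [0..<q] = map e' [0..<q]" using e'(1) by simp
  show "has_grid (arranged M \<phi> n k q (map e [0..<q])) (replicate n N)"
    unfolding params has_grid_replicate using grid_env_arranged[OF e'(2)] grid_env_inj[OF e'(2)]
    by (intro exI[of _ "\<lambda>i l. map e' (slot q k i l)"]) simp
next
  assume "has_grid (arranged M \<phi> n k q (map e [0..<q])) (replicate n N)"
  then obtain a where a: "\<And>i. i < n \<Longrightarrow> inj_on (a i) {..<N}"
    "\<And>\<eta>. (\<forall>i<n. \<eta> i < N) \<Longrightarrow>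
      arranged M \<phi> n k q (map e [0..<q]) (map (\<lambda>i. a i (\<eta> i)) [0..<n])"
    unfolding has_grid_replicate by blast
  have len: "length (a i l) = k i" if "i < n" "l < N" for i l
  proof -
    have "map length (map (\<lambda>i. a i l) [0..<n]) = map k [0..<n]"
      using a(2)[of "\<lambda>_. l"] that unfolding arranged_def by blast
    then show ?thesis using that(1) by (auto simp: list_eq_iff_nth_eq)
  qed
  define e' where "e' m = (if m < q then e m else
    case prod_decode (m - q) of (i, s) \<Rightarrow> case prod_decode s of (l, v) \<Rightarrow> a i l ! v)" for m
  have slot_eq: "map e' (slot q k i l) = a i l" if "i < n" "l < N" for i l
    using len[OF that] by (auto simp: slot_def e'_def intro: nth_equalityI)
  have params: "map e' [0..<q] = map e [0..<q]" by (simp add: e'_def)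
  have "holds M \<phi> (map e' (concat (map (\<lambda>i. slot q k i (\<eta> i)) [0..<n]) @ [0..<q]))"
    if \<eta>PiE: "\<eta> \<in> PiE {..<n} (\<lambda>_. {..<N})" for \<eta>
  proof -
    have \<eta>: "\<forall>i<n. \<eta> i < N" using \<eta>PiE by (auto simp: PiE_iff)
    then have slots: "map (\<lambda>i. map e' (slot q k i (\<eta> i))) [0..<n] = map (\<lambda>i. a i (\<eta> i)) [0..<n]"
      using slot_eq by simp
    show ?thesis
      unfolding arranged_slots[symmetric] params slots by (rule a(2)[OF \<eta>])
  qed
  moreover have "map e' (slot q k i l) \<noteq> map e' (slot q k i l')" if "i < n" "l < N" "l' < l" for i l l'
    using a(1)[OF that(1)] that slot_eq unfolding inj_on_def
    by (metis lessThan_iff less_irrefl order_less_trans)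
  ultimately have "grid_env M \<phi> n k q N e'" unfolding grid_env_def by blast
  then show "\<exists>e'. (\<forall>i<q. e' i = e i) \<and> grid_env M \<phi> n k q N e'"
    by (intro exI[of _ e']) (simp add: e'_def)
qed

text \<open>The grid conditions weaken as \<open>N\<close> decreases, so saturation satisfies all of
  them at once, with the values of \<open>c\<close> held fixed.\<close>

lemma broad_iff_has_grid:
  fixes M :: "('f, 'p, 'm) struct"
  assumes sat: "saturated L \<kappa> M" "natLeq <o \<kappa>"
    and \<phi>: "\<phi> \<in> formulas L (sum_list (map k [0..<n]) + q)"
    and Y: "Y \<subseteq> cart_prod n X" "\<And>xs. xs \<in> Y \<longleftrightarrow> arranged M \<phi> n k q c xs" and c: "length c = q"
  shows "broad n X Y \<longleftrightarrow> (\<forall>N. has_grid (arranged M \<phi> n k q c) (replicate n N))"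
proof
  assume "broad n X Y"
  then obtain a :: "nat \<Rightarrow> nat \<Rightarrow> 'm list" where a: "\<And>i. i < n \<Longrightarrow> inj (a i)"
    "\<And>\<eta> :: nat \<Rightarrow> nat. map (\<lambda>i. a i (\<eta> i)) [0..<n] \<in> Y"
    unfolding broad_def by blast
  show "\<forall>N. has_grid (arranged M \<phi> n k q c) (replicate n N)"
    unfolding has_grid_replicate Y(2)[symmetric]
    using a by (blast intro: inj_on_subset)
next
  assume grid: "\<forall>N. has_grid (arranged M \<phi> n k q c) (replicate n N)"
  have c_map: "map ((!) c) [0..<q] = c" using c map_nth by metis
  have "\<exists>e'. (\<forall>i<q. e' i = c ! i) \<and> grid_env M \<phi> n k q N e'" for N
    using grid grid_env_iff[of q "(!) c" M \<phi> n k N] unfolding c_map by blast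
  then have "\<exists>e'. (\<forall>i<q. e' i = c ! i) \<and> (\<forall>N. grid_env M \<phi> n k q N e')"
    by (intro chain_imp_sat[OF sat] expressible_grid_env[OF \<phi>]) (auto intro: grid_env_mono)
  then obtain e where e: "\<forall>i<q. e i = c ! i" "\<And>N. grid_env M \<phi> n k q N e" by blast
  define a where "a i l = map e (slot q k i l)" for i l
  have e_c: "map e [0..<q] = c" using e(1) c by (intro nth_equalityI) auto
  have aY: "map (\<lambda>i. a i (\<eta> i)) [0..<n] \<in> Y" for \<eta>
  proof -
    have "finite (\<eta> ` {..<n})" by simp
    then obtain N where "\<forall>i<n. \<eta> i < N" by (auto simp: finite_nat_set_iff_bounded)
    then show ?thesis using grid_env_arranged[OF e(2)] unfolding Y(2) a_def e_c by blast
  qed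
  \<comment> \<open>Constant choice functions show that every candidate occurs in some member of
    \<open>Y\<close>.\<close>
  have "a i l \<in> X i" if "i < n" for i l
    using aY[of "\<lambda>_. l"] Y(1) that unfolding cart_prod_def by force
  moreover have "inj (a i)" if "i < n" for i
  proof (rule injI)
    fix l l' assume "a i l = a i l'"
    moreover have "inj_on (a i) {..<Suc (max l l')}"
      unfolding a_def using grid_env_inj[OF e(2) that] .
    ultimately show "l = l'" by (auto simp: inj_on_def)
  qed
  ultimately show "broad n X Y" unfolding broad_def using aY by blast
qed

theorem theorem3p10:
  fixes L :: "('f, 'p) language"
    and T :: "('f, 'p) fm set"
    and \<kappa> :: "'k rel"
    and M :: "('f, 'p, 'm) struct"
    and n r :: nat
    and k :: "nat \<Rightarrow> nat"
    and X :: "nat \<Rightarrow> 'm list set"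
    and Z :: "'m list set"
    and Y :: "'m list \<Rightarrow> 'm list list set"
  assumes "T \<subseteq> formulas L 0"
    and "NIP TYPE('m) L T"
    and "eliminates_exists_infinity TYPE('m) L T"
    and "monster_model L T \<kappa> M"
    and "\<forall>i<n. definable L M (k i) (X i)"
    and "definable_family L M n k X r Z Y"
  shows "definable L M r {b \<in> Z. broad n X (Y b)}"
proof -
  have M: "is_model M T" and sat: "saturated L \<kappa> M" "natLeq <o \<kappa>"
    using assms(4) unfolding monster_model_def by auto
  let ?K = "sum_list (map k [0..<n])"
  have K: "(\<Sum>i<n. k i) = ?K"
    by (simp add: interv_sum_list_conv_sum_set_nat atLeast0LessThan)
  have Z: "definable L M r Z" and YX: "\<And>b. b \<in> Z \<Longrightarrow> Y b \<subseteq> cart_prod n X"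
    and total: "definable L M (?K + r) {concat xs @ b | xs b. b \<in> Z \<and> xs \<in> Y b}"
    using assms(6) unfolding definable_family_def K by auto
  obtain pz \<zeta> where \<zeta>: "\<zeta> \<in> formulas L (r + length pz)"
    "Z = {b. length b = r \<and> holds M \<zeta> (b @ pz)}"
    using Z unfolding definable_def by blast
  obtain ps \<phi> where \<phi>: "\<phi> \<in> formulas L (?K + r + length ps)"
    "{concat xs @ b | xs b. b \<in> Z \<and> xs \<in> Y b} = {xs. length xs = ?K + r \<and> holds M \<phi> (xs @ ps)}"
    using total unfolding definable_def by blast
  define q where "q = r + length ps"
  have \<phi>q: "\<phi> \<in> formulas L (?K + q)" using \<phi>(1) by (simp add: q_def add.assoc)
  have X_len: "length x = k i" if "i < n" "x \<in> X i" for i x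
    using assms(5) that unfolding definable_def by blast
  have Y_len: "map length xs = map k [0..<n]" if "b \<in> Z" "xs \<in> Y b" for b xs
    using YX[OF that(1)] that(2) X_len unfolding cart_prod_def by (auto intro!: nth_equalityI)
  have Y_iff: "xs \<in> Y b \<longleftrightarrow> arranged M \<phi> n k q (b @ ps) xs" if b: "b \<in> Z" for b xs
  proof
    have b_len: "length b = r" using b \<zeta>(2) by blast
    {
      assume xs: "xs \<in> Y b"
      then have "concat xs @ b \<in> {xs. length xs = ?K + r \<and> holds M \<phi> (xs @ ps)}"
        using b \<phi>(2) by blast
      then show "arranged M \<phi> n k q (b @ ps) xs"
        using Y_len[OF b xs] b_len unfolding arranged_def q_def by simp
    next
      assume xs: "arranged M \<phi> n k q (b @ ps) xs"
      then have len: "map length xs = map k [0..<n]" unfolding arranged_def by blast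
      have "concat xs @ b \<in> {xs. length xs = ?K + r \<and> holds M \<phi> (xs @ ps)}"
        using xs len b_len unfolding arranged_def by (simp add: length_concat)
      \<comment> \<open>The total set determines its pairs: \<open>b\<close> is the suffix of length
        \<open>r\<close>, and the tuples are recovered from their lengths.\<close>
      then obtain xs' b' where b': "concat xs @ b = concat xs' @ b'" "b' \<in> Z" "xs' \<in> Y b'"
        unfolding \<phi>(2)[symmetric] by blast
      have "length b' = r" using b'(2) \<zeta>(2) by blast
      then have "b' = b" "concat xs' = concat xs" using b'(1) b_len by auto
      moreover have len': "map length xs' = map length xs" using Y_len[OF b'(2,3)] len by simp
      moreover have "length xs' = length xs" using len' by (rule map_eq_imp_length_eq)
      moreover from this have "length (xs' ! i) = length (xs ! i)" if "i < length xs'" for i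
        using len' that by (metis nth_map)
      ultimately have "xs' = xs"
        using concat_injective[of xs' xs] by (auto simp: set_zip)
      then show "xs \<in> Y b" using b'(3) \<open>b' = b\<close> by simp
    }
  qed
  have "\<exists>N. \<forall>c. has_grid (arranged M \<phi> n k q c) (replicate n N) \<longrightarrow>
      (\<forall>N. has_grid (arranged M \<phi> n k q c) (replicate n N))"
    by (rule uniform_grid_bound)
      (use arranged_vc[OF assms(2) M \<phi>q] arranged_infinite[OF assms(3) M sat \<phi>q] in blast)+
  then obtain N where N: "\<And>c. has_grid (arranged M \<phi> n k q c) (replicate n N) \<Longrightarrow>
      \<forall>N. has_grid (arranged M \<phi> n k q c) (replicate n N)" by blast
  \<comment> \<open>For this \<open>N\<close> an \<open>N\<close>-grid forces grids of every size,
    so \<open>\<chi>\<close> alone captures broadness.\<close>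
  obtain \<chi> where \<chi>: "\<chi> \<in> formulas L q"
    "\<And>e. sat M e \<chi> \<longleftrightarrow> (\<exists>e'. (\<forall>i<q. e' i = e i) \<and> grid_env M \<phi> n k q N e')"
    using expressible_restrict[OF expressible_grid_env[OF \<phi>q]] by blast
  have \<chi>_broad: "holds M \<chi> (b @ ps) \<longleftrightarrow> broad n X (Y b)" if b: "b \<in> Z" for b
  proof -
    have len: "length (b @ ps) = q" using b \<zeta>(2) unfolding q_def by auto
    have "holds M \<chi> (b @ ps) \<longleftrightarrow> has_grid (arranged M \<phi> n k q (b @ ps)) (replicate n N)"
      unfolding holds_def \<chi>(2) grid_env_iff using map_nth[of "b @ ps"] len by simp
    also have "\<dots> \<longleftrightarrow> broad n X (Y b)"
      using broad_iff_has_grid[OF sat \<phi>q YX[OF b] Y_iff[OF b] len] N by blast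
    finally show ?thesis .
  qed
  let ?m = "r + length (pz @ ps)"
  let ?jz = "[0..<r + length pz]" and ?jc = "[0..<r] @ [r + length pz..<?m]"
  have "\<zeta> \<in> formulas L (length ?jz)" "\<chi> \<in> formulas L (length ?jc)"
    using \<zeta>(1) \<chi>(1) unfolding q_def by simp_all
  moreover have "set ?jz \<subseteq> {..<?m}" "set ?jc \<subseteq> {..<?m}" by auto
  ultimately obtain \<zeta>' \<chi>' where form: "\<zeta>' \<in> formulas L ?m" "\<chi>' \<in> formulas L ?m"
    and \<zeta>': "\<And>xs. length xs = ?m \<Longrightarrow> holds M \<zeta>' xs \<longleftrightarrow> holds M \<zeta> (map ((!) xs) ?jz)"
    and \<chi>': "\<And>xs. length xs = ?m \<Longrightarrow> holds M \<chi>' xs \<longleftrightarrow> holds M \<chi> (map ((!) xs) ?jc)"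
    using formulas_reindex[of \<zeta> L ?jz ?m M] formulas_reindex[of \<chi> L ?jc ?m M] by blast
  have "holds M (Conj \<zeta>' \<chi>') (b @ pz @ ps) \<longleftrightarrow> b \<in> Z \<and> broad n X (Y b)" if b: "length b = r" for b
  proof -
    have "map ((!) (b @ pz @ ps)) ?jz = b @ pz"
      using map_nth_infix[of "[]" "b @ pz" ps] b by simp
    moreover have "map ((!) (b @ pz @ ps)) ?jc = b @ ps"
      using map_nth_infix[of "[]" b "pz @ ps"] map_nth_infix[of "b @ pz" ps "[]"] b
      by (simp add: add.assoc)
    ultimately have "holds M \<zeta>' (b @ pz @ ps) \<longleftrightarrow> b \<in> Z"
      "holds M \<chi>' (b @ pz @ ps) \<longleftrightarrow> holds M \<chi> (b @ ps)"
      using \<zeta>'[of "b @ pz @ ps"] \<chi>'[of "b @ pz @ ps"] b \<zeta>(2) by simp_all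
    then show ?thesis using \<chi>_broad unfolding holds_def by auto
  qed
  then have "{b \<in> Z. broad n X (Y b)} =
      {b. length b = r \<and> holds M (Conj \<zeta>' \<chi>') (b @ pz @ ps)}"
    using \<zeta>(2) by blast
  moreover have "Conj \<zeta>' \<chi>' \<in> formulas L ?m" using form by (simp add: formulas_def)
  ultimately show ?thesis unfolding definable_def by blast
qed

end
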